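(* Let $k$ be a field of characteristic $p>0$, let $t\in k^*$, and let $\epsilon$ be the $k$-algebra automorphism of $k[x_1,x_2]$ with $\epsilon(x_1)=x_1+t$, $\epsilon(x_2)=x_2$. Let $C(\epsilon)$ be the centralizer of $\epsilon$ in $\mathrm{Aut}_k k[x_1,x_2]$. Let $H(t)$ be the subgroup of $\mathrm{Aut}_k k[x_1,x_2]$ generated by $$(x_1+g(x_2),\,x_2)\quad\text{and}\quad (x_1,\,x_2+g(x_1^p-t^{p-1}x_1))\qquad\text{for all } g(x)\in xk[x],$$ and let $H_0:=\{(x_1+u_1,ax_2+u_2)\mid a\in k^*,\ u_1,u_2\in k\}$. Then $C(\epsilon)=H(t)H_0$.
   Context: $(f_1,f_2)$ denotes the $k$-algebra endomorphism of $k[x_1,x_2]$ sending $x_i$ to $f_i$; the product in $\mathrm{Aut}_k k[x_1,x_2]$ is composition of maps, so $\phi\circ(g_1,g_2)=(\phi(g_1),\phi(g_2))$. $H(t)H_0=\{\alpha\beta\mid\alpha\in H(t),\beta\in H_0\}$. *)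

theory Defs
  imports
    "HOL-Algebra.Generated_Groups"
    "HOL-Computational_Algebra.Polynomial"
begin

text \<open>
  The ring \<open>k[x\<^sub>1,x\<^sub>2]\<close> is represented by the type \<open>'a poly poly\<close>, i.e. as
  \<open>(k[x\<^sub>1])[x\<^sub>2]\<close>: the variable \<open>x\<^sub>2\<close> is the outer one.
\<close>

definition const2 :: "'a::comm_ring_1 \<Rightarrow> 'a poly poly" where
  "const2 a = [:[:a:]:]"

definition X1 :: "'a::comm_ring_1 poly poly" where
  "X1 = [:[:0, 1:]:]"

definition X2 :: "'a::comm_ring_1 poly poly" where
  "X2 = [:0, 1:]"

text \<open>Substitution \<open>g(f)\<close> of \<open>f \<in> k[x\<^sub>1,x\<^sub>2]\<close> into \<open>g \<in> k[x]\<close>.\<close>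

definition eval1 :: "'a::comm_ring_1 poly \<Rightarrow> 'a poly poly \<Rightarrow> 'a poly poly" where
  "eval1 g f = poly (map_poly const2 g) f"

text \<open>The endomorphism \<open>(f\<^sub>1, f\<^sub>2)\<close>; \<open>kalg_endo_endo2\<close> and \<open>kalg_endo_eq_endo2\<close> below show that it
  is the unique \<open>k\<close>-algebra endomorphism sending \<open>x\<^sub>i\<close> to \<open>f\<^sub>i\<close>.\<close>

definition endo2 ::
    "'a::comm_ring_1 poly poly \<Rightarrow> 'a poly poly \<Rightarrow> 'a poly poly \<Rightarrow> 'a poly poly" where
  "endo2 f1 f2 q = poly (map_poly (\<lambda>c. eval1 c f1) q) f2"

definition kalg_endo :: "('a::comm_ring_1 poly poly \<Rightarrow> 'a poly poly) \<Rightarrow> bool" where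
  "kalg_endo \<phi> \<longleftrightarrow>
     (\<forall>u v. \<phi> (u + v) = \<phi> u + \<phi> v) \<and>
     (\<forall>u v. \<phi> (u * v) = \<phi> u * \<phi> v) \<and>
     (\<forall>a. \<phi> (const2 a) = const2 a)"

definition kAut :: "('a::comm_ring_1 poly poly \<Rightarrow> 'a poly poly) monoid" where
  "kAut = \<lparr>carrier = {\<phi>. kalg_endo \<phi> \<and> bij \<phi>}, monoid.mult = (\<circ>), one = id\<rparr>"

definition centralizer :: "('g, 'm) monoid_scheme \<Rightarrow> 'g \<Rightarrow> 'g set" where
  "centralizer G x = {y \<in> carrier G. y \<otimes>\<^bsub>G\<^esub> x = x \<otimes>\<^bsub>G\<^esub> y}"

text \<open>In \<open>H_grp\<close> the condition \<open>g \<in> xk[x]\<close> is expressed by \<open>coeff g 0 = 0\<close>; \<open>p\<close> is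
  meant to be the (positive) characteristic, so the natural number subtraction is harmless.\<close>

definition H_grp :: "nat \<Rightarrow> 'a::field \<Rightarrow> ('a poly poly \<Rightarrow> 'a poly poly) set" where
  "H_grp p t = generate kAut
     ({endo2 (X1 + eval1 g X2) X2 | g. coeff g 0 = 0} \<union>
      {endo2 X1 (X2 + eval1 g (X1 ^ p - const2 (t ^ (p - 1)) * X1)) | g. coeff g 0 = 0})"

definition H0 :: "('a::field poly poly \<Rightarrow> 'a poly poly) set" where
  "H0 = {endo2 (X1 + const2 u1) (const2 a * X2 + const2 u2) | a u1 u2. a \<noteq> 0}"

lemma const2_hom:
  "const2 0 = 0" "const2 1 = 1"
  "const2 (a + b) = const2 a + const2 b" "const2 (a * b) = const2 a * const2 b"
  by (simp_all add: const2_def one_pCons)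

lemma poly_map_poly_add:
  fixes h :: "'b::comm_ring_1 \<Rightarrow> 'c::comm_ring_1"
  assumes "h 0 = 0" "\<And>a b. h (a + b) = h a + h b"
  shows "poly (map_poly h (u + v)) f = poly (map_poly h u) f + poly (map_poly h v) f"
proof -
  have "map_poly h (u + v) = map_poly h u + map_poly h v"
    by (rule poly_eqI) (simp add: coeff_map_poly assms)
  then show ?thesis by simp
qed

lemma poly_map_poly_mult:
  fixes h :: "'b::comm_ring_1 \<Rightarrow> 'c::comm_ring_1"
  assumes h: "h 0 = 0" "\<And>a b. h (a + b) = h a + h b" "\<And>a b. h (a * b) = h a * h b"
  shows "poly (map_poly h (u * v)) f = poly (map_poly h u) f * poly (map_poly h v) f"
proof (induction u)
  case (pCons a u)
  then show ?case
    by (simp add: map_poly_pCons poly_map_poly_add map_poly_smult h algebra_simps)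
qed simp

lemma eval1_hom:
  "eval1 0 f = 0" "eval1 [:a:] f = const2 a" "eval1 1 f = 1"
  "eval1 (g + h) f = eval1 g f + eval1 h f"
  "eval1 (g * h) f = eval1 g f * eval1 h f"
  unfolding eval1_def
  by (simp_all add: const2_hom map_poly_pCons poly_map_poly_add poly_map_poly_mult)

lemma eval1_pCons: "eval1 (pCons a g) f = const2 a + f * eval1 g f"
  by (simp add: eval1_def map_poly_pCons const2_hom)

lemma endo2_pCons: "endo2 f1 f2 (pCons c q) = eval1 c f1 + f2 * endo2 f1 f2 q"
  by (simp add: endo2_def map_poly_pCons eval1_hom)

lemma kalg_endo_endo2: "kalg_endo (endo2 f1 f2)"
proof -
  have "endo2 f1 f2 (const2 a) = const2 a" for a
    unfolding const2_def[of a] by (simp add: endo2_def map_poly_pCons eval1_hom const2_def)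
  then show ?thesis
    by (simp add: kalg_endo_def) (simp add: endo2_def poly_map_poly_add poly_map_poly_mult eval1_hom)
qed

lemma endo2_X1 [simp]: "endo2 f1 f2 X1 = f1"
  and endo2_X2 [simp]: "endo2 f1 f2 X2 = f2"
  by (simp_all add: X1_def X2_def endo2_def map_poly_pCons eval1_pCons eval1_hom const2_hom)

lemma kalg_endo_eq_endo2:
  assumes "kalg_endo \<phi>"
  shows "\<phi> = endo2 (\<phi> X1) (\<phi> X2)"
proof
  have add: "\<phi> (u + v) = \<phi> u + \<phi> v" and mult: "\<phi> (u * v) = \<phi> u * \<phi> v"
    and const: "\<phi> (const2 a) = const2 a" for u v a
    using assms by (auto simp: kalg_endo_def)
  have zero: "\<phi> 0 = 0"
    using const[of 0] by (simp only: const2_hom)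
  have inner: "\<phi> [:c:] = eval1 c (\<phi> X1)" for c
  proof (induction c)
    case (pCons a c)
    have "[:pCons a c:] = const2 a + X1 * [:c:]"
      by (simp add: const2_def X1_def)
    then have "\<phi> [:pCons a c:] = const2 a + \<phi> X1 * \<phi> [:c:]"
      by (simp only: add mult const)
    then show ?case
      by (simp only: pCons.IH eval1_pCons)
  qed (simp add: zero eval1_hom)
  show "\<phi> q = endo2 (\<phi> X1) (\<phi> X2) q" for q
  proof (induction q)
    case (pCons c q)
    have "pCons c q = [:c:] + X2 * q"
      by (simp add: X2_def)
    then have "\<phi> (pCons c q) = \<phi> [:c:] + \<phi> X2 * \<phi> q"
      by (simp only: add mult)
    then show ?case
      by (simp add: inner pCons.IH endo2_pCons)
  qed (simp add: zero endo2_def)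
qed

lemma group_kAut: "group kAut"
proof (rule groupI)
  fix \<phi> :: "'a poly poly \<Rightarrow> 'a poly poly"
  assume "\<phi> \<in> carrier kAut"
  then have e: "kalg_endo \<phi>" and b: "bij \<phi>"
    by (auto simp: kAut_def)
  have s: "\<phi> (the_inv \<phi> u) = u" "the_inv \<phi> (\<phi> u) = u" for u
    using b by (auto simp: bij_def the_inv_f_f f_the_inv_into_f)
  have "the_inv \<phi> (u + v) = the_inv \<phi> u + the_inv \<phi> v"
    "the_inv \<phi> (u * v) = the_inv \<phi> u * the_inv \<phi> v"
    "the_inv \<phi> (const2 a) = const2 a" for u v a
    using e s unfolding kalg_endo_def by metis+
  then have "kalg_endo (the_inv \<phi>)"
    by (simp add: kalg_endo_def)
  moreover have "bij (the_inv \<phi>)"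
    by (rule o_bij[of \<phi>]) (auto simp: fun_eq_iff s)
  moreover have "the_inv \<phi> \<circ> \<phi> = id"
    by (auto simp: fun_eq_iff s)
  ultimately show "\<exists>\<psi>\<in>carrier kAut. \<psi> \<otimes>\<^bsub>kAut\<^esub> \<phi> = \<one>\<^bsub>kAut\<^esub>"
    by (auto simp: kAut_def)
qed (auto simp: kAut_def kalg_endo_def bij_comp comp_assoc)

end

theory Submission
  imports
    Defs
    "HOL-Computational_Algebra.Formal_Laurent_Series"
    "HOL-Number_Theory.Cong"
begin

text \<open>
  An automorphism \<open>\<phi> = (f, g)\<close> commutes with \<open>\<epsilon>\<close> iff \<open>\<epsilon> f = f + t\<close> and \<open>\<epsilon> g = g\<close>.
  Such a \<open>\<phi>\<close> is multiplied from the right by elements of \<open>H(t)\<close> so as to decrease the sum of the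
  degrees in \<open>x\<^sub>2\<close> of \<open>f\<close> and \<open>g\<close>, until \<open>f \<in> k[x\<^sub>1]\<close>; applied to the inverse, this puts every
  element of \<open>C(\<epsilon>)\<close> into \<open>H(t)H\<^sub>0\<close>.

  The reduction rests on the following form of the Jung--van der Kulk theorem: if both degrees are
  positive, then one leading coefficient is a scalar multiple of a power of the other one, with
  matching degrees. Let \<open>(F, G)\<close> be the inverse automorphism and give \<open>u, v\<close> the weights
  \<open>deg f, deg g\<close>. As \<open>F(f, g) = x\<^sub>1\<close> has degree \<open>0\<close>, the top weighted part of \<open>F\<close> vanishes on
  the leading coefficients, hence is divisible by some \<open>P = u\<^sup>a - c v\<^sup>b\<close> with coprime \<open>a, b\<close>.
  Conjugating the translations \<open>x\<^sub>2 \<mapsto> x\<^sub>2 + T\<close> by the automorphism gives a flow on \<open>k[u, v]\<close> fixing \<open>F\<close>,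
  and the leading part of this flow, for a suitable weight of \<open>T\<close>, is nontrivial and fixes the top
  part of \<open>F\<close>, hence its factor \<open>P\<close>. If \<open>a, b \<ge> 2\<close> this is impossible, because the curves \<open>P = const\<close>
  admit no such flow, in any characteristic.

  If \<open>deg g > deg f\<close>, the reduction of \<open>g\<close> by a polynomial \<open>q(f)\<close> until \<open>deg (g - q(f)) < deg f\<close>
  shows, on comparing with the image under \<open>\<epsilon>\<close>, that \<open>q(x + t) - q(x)\<close> is constant. Hence \<open>q\<close> is a linear
  term plus a polynomial in \<open>x\<^sup>p - t\<^sup>p\<^sup>-\<^sup>1 x\<close>, and the latter is removed by a generator of \<open>H(t)\<close>.
\<close>

subsection \<open>Evaluation, weighted parts and leading terms\<close>

locale comm_hom =
  fixes h :: "'r::comm_ring_1 \<Rightarrow> 's::comm_ring_1"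
  assumes hom_one [simp]: "h 1 = 1"
    and hom_add: "h (a + b) = h a + h b"
    and hom_mult: "h (a * b) = h a * h b"
begin

lemma hom_zero [simp]: "h 0 = 0"
  using hom_add[of 0 0] by simp

lemma hom_uminus: "h (- a) = - h a"
  using hom_add[of a "- a"] by (simp add: eq_neg_iff_add_eq_0 add.commute)

lemma hom_diff: "h (a - b) = h a - h b"
  using hom_add[of a "- b"] by (simp add: hom_uminus)

lemma hom_power: "h (a ^ n) = h a ^ n"
  by (induction n) (simp_all add: hom_mult)

lemma hom_sum: "h (\<Sum>i\<in>A. f i) = (\<Sum>i\<in>A. h (f i))"
  by (induction A rule: infinite_finite_induct) (simp_all add: hom_add)

lemma comm_hom_poly_map_poly: "comm_hom (\<lambda>c. poly (map_poly h c) r)"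
  by standard
    (simp_all add: one_pCons map_poly_pCons poly_map_poly_add poly_map_poly_mult hom_add hom_mult
      del: pCons_one)

lemma poly_map_poly_sum:
  "poly (map_poly h c) r = (\<Sum>i | coeff c i \<noteq> 0. h (coeff c i) * r ^ i)"
proof -
  have "poly (map_poly h c) r = (\<Sum>i\<le>degree (map_poly h c). h (coeff c i) * r ^ i)"
    by (simp add: poly_altdef coeff_map_poly)
  also have "\<dots> = (\<Sum>i\<le>degree c. h (coeff c i) * r ^ i)"
    by (rule sum.mono_neutral_left)
      (auto simp: map_poly_degree_leq coeff_map_poly[symmetric] coeff_eq_0)
  also have "\<dots> = (\<Sum>i | coeff c i \<noteq> 0. h (coeff c i) * r ^ i)"
    by (rule sum.mono_neutral_right) (auto simp: le_degree)
  finally show ?thesis .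
qed

end

lemma comm_hom_comp: "comm_hom f \<Longrightarrow> comm_hom g \<Longrightarrow> comm_hom (\<lambda>x. f (g x))"
  by (simp add: comm_hom_def)

lemma comm_hom_const2: "comm_hom const2"
  by unfold_locales (simp_all add: const2_hom)

lemma comm_hom_const_poly: "comm_hom (\<lambda>a. [:a:])"
  by unfold_locales (simp_all add: one_pCons)

lemma hom_poly_map_poly:
  assumes "comm_hom \<psi>" "comm_hom h"
  shows "\<psi> (poly (map_poly h c) r) = poly (map_poly (\<lambda>a. \<psi> (h a)) c) (\<psi> r)"
proof -
  interpret \<psi>: comm_hom \<psi> by fact
  interpret h: comm_hom h by fact
  interpret c: comm_hom "\<lambda>a. \<psi> (h a)" by (rule comm_hom_comp) fact+
  show ?thesis
    by (induction c) (simp_all add: map_poly_pCons \<psi>.hom_add \<psi>.hom_mult)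
qed

text \<open>The target ring is arbitrary because the same polynomial is evaluated in
  \<open>k[x1,x2]\<close>, at leading coefficients, along a flow with parameter \<open>T\<close>,
  and in Laurent series.\<close>

definition eval2 ::
    "('a::comm_ring_1 \<Rightarrow> 'r::comm_ring_1) \<Rightarrow> 'r \<Rightarrow> 'r \<Rightarrow> 'a poly poly \<Rightarrow> 'r" where
  "eval2 h r s q = poly (map_poly (\<lambda>c. poly (map_poly h c) r) q) s"

lemma endo2_eval2: "endo2 f g = eval2 const2 f g"
  by (simp add: fun_eq_iff endo2_def eval2_def eval1_def)

lemma comm_hom_eval2: "comm_hom h \<Longrightarrow> comm_hom (eval2 h r s)"
  unfolding eval2_def by (intro comm_hom.comm_hom_poly_map_poly)

lemma comm_hom_endo2: "comm_hom (endo2 f g)"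
  unfolding endo2_eval2 by (rule comm_hom_eval2[OF comm_hom_const2])

lemma hom_eval2:
  assumes "comm_hom \<psi>" "comm_hom h"
  shows "\<psi> (eval2 h r s q) = eval2 (\<lambda>a. \<psi> (h a)) (\<psi> r) (\<psi> s) q"
  unfolding eval2_def
  by (simp add: hom_poly_map_poly assms comm_hom.comm_hom_poly_map_poly)

lemma eval2_X [simp]:
  assumes "comm_hom h"
  shows "eval2 h r s X1 = r" "eval2 h r s X2 = s" "eval2 h r s (const2 a) = h a"
proof -
  interpret comm_hom h by fact
  show "eval2 h r s X1 = r" "eval2 h r s X2 = s" "eval2 h r s (const2 a) = h a"
    by (simp_all add: eval2_def X1_def X2_def const2_def map_poly_pCons)
qed

section \<open>Supports, weighted parts and leading terms\<close>

definition mon2 :: "'a::zero poly poly \<Rightarrow> (nat \<times> nat) set" where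
  "mon2 q = {(i, j). coeff (coeff q j) i \<noteq> 0}"

lemma mon2_Sigma: "mon2 q = (\<lambda>(j, i). (i, j)) ` (SIGMA j:{j. coeff q j \<noteq> 0}. {i. coeff (coeff q j) i \<noteq> 0})"
  by (auto simp: mon2_def)

lemma finite_coeff_nz [simp]: "finite {i. coeff c i \<noteq> 0}"
  by (rule finite_subset[of _ "{..degree c}"]) (auto simp: le_degree)

lemma finite_mon2 [simp]: "finite (mon2 q)"
  unfolding mon2_Sigma by (intro finite_imageI finite_SigmaI) auto

lemma mon2_eq_empty_iff: "mon2 q = {} \<longleftrightarrow> q = 0"
  by (auto simp: mon2_def poly_eq_iff)

lemma eval2_sum:
  assumes "comm_hom h"
  shows "eval2 h r s q = (\<Sum>(i, j)\<in>mon2 q. h (coeff (coeff q j) i) * r ^ i * s ^ j)"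
proof -
  interpret comm_hom h by fact
  have inj: "inj_on (\<lambda>(j, i). (i, j)) S" for S :: "(nat \<times> nat) set"
    by (auto simp: inj_on_def)
  have "eval2 h r s q =
      (\<Sum>j | coeff q j \<noteq> 0. (\<Sum>i | coeff (coeff q j) i \<noteq> 0. h (coeff (coeff q j) i) * r ^ i) * s ^ j)"
    unfolding eval2_def
    by (subst comm_hom.poly_map_poly_sum[OF comm_hom_poly_map_poly]) (simp add: poly_map_poly_sum)
  also have "\<dots> = (\<Sum>(i, j)\<in>mon2 q. h (coeff (coeff q j) i) * r ^ i * s ^ j)"
    unfolding mon2_Sigma
    by (subst sum.reindex[OF inj]) (simp add: sum.Sigma sum_distrib_right case_prod_unfold)
  finally show ?thesis .
qed

lemma eval2_X1_X2: "eval2 const2 X1 X2 q = q"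
proof -
  have "kalg_endo (\<lambda>q :: 'a poly poly. q)" by (simp add: kalg_endo_def)
  from kalg_endo_eq_endo2[OF this] show ?thesis by (metis endo2_eval2)
qed

lemma monom2: "const2 c * X1 ^ i * X2 ^ j = monom (monom c i) j"
proof -
  have 1: "X2 ^ j = (monom 1 j :: 'b :: comm_ring_1 poly poly)" for j
    by (simp add: X2_def monom_altdef)
  have 2: "X1 ^ i = ([:monom 1 i:] :: 'b :: comm_ring_1 poly poly)" for i
    by (induction i) (simp_all add: X1_def monom_Suc mult.commute)
  show ?thesis by (simp add: 1 2 const2_def smult_monom)
qed

text \<open>Weights in \<open>nat\<close> serve for degrees in \<open>x2\<close>; weights in
  \<open>int\<close> serve for the flow, where the target weight may be negative.\<close>

definition wpart :: "'w::linordered_semidom \<Rightarrow> 'w \<Rightarrow> 'w \<Rightarrow> 'a::comm_ring_1 poly poly \<Rightarrow> 'a poly poly"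
  where "wpart e1 e2 w q =
    (\<Sum>(i, j) \<in> {(i, j) \<in> mon2 q. of_nat i * e1 + of_nat j * e2 = w}.
       const2 (coeff (coeff q j) i) * X1 ^ i * X2 ^ j)"

lemma coeff_wpart:
  "coeff (coeff (wpart e1 e2 w q) j) i =
     (if of_nat i * e1 + of_nat j * e2 = w then coeff (coeff q j) i else 0)"
proof -
  let ?M = "{(i, j) \<in> mon2 q. of_nat i * e1 + of_nat j * e2 = w}"
  have fin: "finite ?M" by (rule finite_subset[of _ "mon2 q"]) auto
  have "coeff (coeff (wpart e1 e2 w q) j) i =
      (\<Sum>x\<in>?M. if x = (i, j) then coeff (coeff q j) i else 0)"
    unfolding wpart_def coeff_sum monom2
    by (rule sum.cong) (auto simp: monom2 split: if_splits)
  then show ?thesis using fin by (auto simp: mon2_def)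
qed

lemma mon2_wpart: "mon2 (wpart e1 e2 w q) = {(i, j) \<in> mon2 q. of_nat i * e1 + of_nat j * e2 = w}"
  by (auto simp: mon2_def coeff_wpart)

lemma eval2_wpart:
  assumes "comm_hom h"
  shows "eval2 h r s (wpart e1 e2 w q) = (\<Sum>(i, j) \<in> mon2 q.
    if of_nat i * e1 + of_nat j * e2 = w then h (coeff (coeff q j) i) * r ^ i * s ^ j else 0)"
  unfolding eval2_sum[OF assms] mon2_wpart
  by (rule sum.mono_neutral_cong_left) (auto simp: coeff_wpart split: if_splits)

text \<open>\<open>lt w r c\<close> reads: \<open>r\<close> has weight at most \<open>w\<close>, and its part of weight exactly \<open>w\<close> is \<open>c\<close>
  (possibly zero).\<close>

locale leading_rel =
  fixes lt :: "'w::linordered_semidom \<Rightarrow> 'r::comm_ring_1 \<Rightarrow> 's::comm_ring_1 \<Rightarrow> bool"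
  assumes lt_zero: "lt w 0 0"
    and lt_one: "lt 0 1 1"
    and lt_add: "lt w r c \<Longrightarrow> lt w r' c' \<Longrightarrow> lt w (r + r') (c + c')"
    and lt_mult: "lt w r c \<Longrightarrow> lt w' r' c' \<Longrightarrow> lt (w + w') (r * r') (c * c')"
    and lt_less: "lt w r c \<Longrightarrow> w < w' \<Longrightarrow> lt w' r 0"
begin

lemma lt_sum: "(\<And>i. i \<in> I \<Longrightarrow> lt w (f i) (g i)) \<Longrightarrow> lt w (sum f I) (sum g I)"
  by (induction I rule: infinite_finite_induct) (auto simp: lt_zero lt_add)

lemma lt_power: "lt w r c \<Longrightarrow> lt (of_nat n * w) (r ^ n) (c ^ n)"
  by (induction n) (auto simp: lt_one algebra_simps dest: lt_mult)

text \<open>Each monomial has a leading value at its own weight. If that weight is below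
  \<open>w\<close>, the value at \<open>w\<close> is \<open>0\<close>, so only the monomials of
  \<open>wpart e1 e2 w q\<close> survive.\<close>

lemma lt_eval2:
  assumes h: "comm_hom h" "comm_hom h'" "\<And>a. lt 0 (h a) (h' a)"
    and r: "lt e1 r c1" and s: "lt e2 s c2"
    and le: "\<And>i j. coeff (coeff q j) i \<noteq> 0 \<Longrightarrow> of_nat i * e1 + of_nat j * e2 \<le> w"
  shows "lt w (eval2 h r s q) (eval2 h' c1 c2 (wpart e1 e2 w q))"
  unfolding eval2_wpart[OF h(2)] eval2_sum[OF h(1)]
proof (rule lt_sum, safe)
  fix i j assume ij: "(i, j) \<in> mon2 q"
  let ?c = "coeff (coeff q j) i"
  have "lt (0 + of_nat i * e1 + of_nat j * e2) (h ?c * r ^ i * s ^ j) (h' ?c * c1 ^ i * c2 ^ j)"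
    by (intro lt_mult lt_power h r s)
  then have *: "lt (of_nat i * e1 + of_nat j * e2) (h ?c * r ^ i * s ^ j) (h' ?c * c1 ^ i * c2 ^ j)"
    by simp
  moreover have "of_nat i * e1 + of_nat j * e2 \<le> w"
    using ij by (auto simp: mon2_def intro: le)
  ultimately show "lt w (h ?c * r ^ i * s ^ j)
      (if of_nat i * e1 + of_nat j * e2 = w then h' ?c * c1 ^ i * c2 ^ j else 0)"
    using lt_less[OF *, of w] by auto
qed

end

section \<open>Two instances: degree and pole order\<close>

definition degree_lt :: "nat \<Rightarrow> 'r::comm_ring_1 poly \<Rightarrow> 'r \<Rightarrow> bool" where
  "degree_lt n r c \<longleftrightarrow> degree r \<le> n \<and> coeff r n = c"

lemma coeff_mult_bound:
  fixes p q :: "'r::comm_ring_1 poly"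
  assumes "degree p \<le> m" "degree q \<le> n"
  shows "coeff (p * q) (m + n) = coeff p m * coeff q n"
proof -
  have "coeff (p * q) (m + n) = (\<Sum>i\<le>m + n. if i = m then coeff p m * coeff q n else 0)"
    unfolding coeff_mult
  proof (rule sum.cong)
    fix i
    show "coeff p i * coeff q (m + n - i) = (if i = m then coeff p m * coeff q n else 0)"
      using assms by (cases i m rule: linorder_cases) (auto simp: coeff_eq_0)
  qed simp
  then show ?thesis by simp
qed

interpretation degree_lt: leading_rel degree_lt
proof
  fix w w' :: nat and r r' :: "'r::comm_ring_1 poly" and c c'
  assume r: "degree_lt w r c"
  {
    assume r': "degree_lt w' r' c'"
    then show "degree_lt (w + w') (r * r') (c * c')"
      using r degree_mult_le[of r r'] by (auto simp: degree_lt_def coeff_mult_bound)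
  }
  assume "w < w'"
  with r show "degree_lt w' r 0" by (auto simp: degree_lt_def coeff_eq_0)
qed (auto simp: degree_lt_def degree_add_le)

text \<open>The weight of a Laurent series is its pole order; this allows variables of negative weight.\<close>

definition fls_lt :: "int \<Rightarrow> 'r::comm_ring_1 fls \<Rightarrow> 'r \<Rightarrow> bool" where
  "fls_lt w r c \<longleftrightarrow> (\<exists>s. r = fls_shift w (fps_to_fls s) \<and> fps_nth s 0 = c)"

lemma fls_lt_unique: "fls_lt w r c \<Longrightarrow> fls_lt w r c' \<Longrightarrow> c = c'"
proof -
  have "fls_nth r (- w) = c" if "fls_lt w r c" for c
    using that by (auto simp: fls_lt_def)
  then show "fls_lt w r c \<Longrightarrow> fls_lt w r c' \<Longrightarrow> c = c'" by blast
qed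

lemma fls_lt_const: "fls_lt 0 (fls_const c) c"
  unfolding fls_lt_def by (rule exI[of _ "fps_const c"]) simp

lemma fls_lt_X_intpow: "fls_lt w (fls_X_intpow (- w)) 1"
  unfolding fls_lt_def by (rule exI[of _ 1]) simp

interpretation fls_lt: leading_rel fls_lt
proof
  fix w w' :: int and r r' :: "'r::comm_ring_1 fls" and c c'
  assume r: "fls_lt w r c"
  then obtain s where s: "r = fls_shift w (fps_to_fls s)" "fps_nth s 0 = c"
    by (auto simp: fls_lt_def)
  {
    assume "fls_lt w' r' c'"
    then obtain s' where s': "r' = fls_shift w' (fps_to_fls s')" "fps_nth s' 0 = c'"
      by (auto simp: fls_lt_def)
    show "fls_lt (w + w') (r * r') (c * c')" unfolding fls_lt_def
      by (rule exI[of _ "s * s'"]) (simp add: s s' fls_times_fps_to_fls fls_shifted_times_simps add.commute)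
  }
  {
    assume "fls_lt w r' c'"
    then obtain s' where s': "r' = fls_shift w (fps_to_fls s')" "fps_nth s' 0 = c'"
      by (auto simp: fls_lt_def)
    show "fls_lt w (r + r') (c + c')" unfolding fls_lt_def
      by (rule exI[of _ "s + s'"]) (simp add: s s')
  }
  assume w: "w < w'"
  show "fls_lt w' r 0" unfolding fls_lt_def
  proof (intro exI conjI)
    \<comment> \<open>Raising the weight moves \<open>w' - w\<close> factors of the variable into
      the power series, which kills its constant term.\<close>
    show "r = fls_shift w' (fps_to_fls (fps_X ^ nat (w' - w) * s))"
      using w by (simp add: s fls_times_fps_to_fls fps_to_fls_power fls_X_power_times_conv_shift)
    show "fps_nth (fps_X ^ nat (w' - w) * s) 0 = 0" using w by simp
  qed
next
  show "fls_lt w 0 0" for w unfolding fls_lt_def by (rule exI[of _ 0]) simp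
  show "fls_lt 0 1 1" using fls_lt_const[of 1] by simp
qed

subsection \<open>Weighted homogeneous polynomials and cusps\<close>

text \<open>The homogenization \<open>y^n q(x/y)\<close> in degree \<open>n\<close>, meant for
  \<open>degree q \<le> n\<close>, with coefficients mapped by \<open>h\<close>.\<close>

definition hmg :: "('a::comm_ring_1 \<Rightarrow> 'r::comm_ring_1) \<Rightarrow> nat \<Rightarrow> 'a poly \<Rightarrow> 'r \<Rightarrow> 'r \<Rightarrow> 'r" where
  "hmg h n q x y = (\<Sum>l\<le>n. h (coeff q l) * x ^ l * y ^ (n - l))"

lemma hmg_linear_mult:
  assumes "comm_hom h" "degree s \<le> n"
  shows "hmg h (Suc n) ([:- c, 1:] * s) x y = (x - h c * y) * hmg h n s x y"
proof -
  interpret comm_hom h by fact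
  have 1: "hmg h (Suc n) (pCons 0 s) x y = x * hmg h n s x y"
    unfolding hmg_def by (subst sum.atMost_Suc_shift) (simp add: sum_distrib_left algebra_simps)
  have "hmg h (Suc n) (smult c s) x y = (\<Sum>l\<le>n. h c * y * (h (coeff s l) * x ^ l * y ^ (n - l)))"
    using assms(2) by (simp add: hmg_def hom_mult coeff_eq_0 Suc_diff_le algebra_simps)
  then have 2: "hmg h (Suc n) (smult c s) x y = h c * y * hmg h n s x y"
    by (simp add: hmg_def sum_distrib_left)
  have "[:- c, 1:] * s = pCons 0 s - smult c s" by simp
  then have "hmg h (Suc n) ([:- c, 1:] * s) x y = hmg h (Suc n) (pCons 0 s) x y - hmg h (Suc n) (smult c s) x y"
    by (simp add: hmg_def hom_diff sum_subtractf algebra_simps del: sum.atMost_Suc)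
  then show ?thesis by (simp add: 1 2 algebra_simps)
qed

lemma hmg_scale:
  assumes "comm_hom h" "degree q \<le> n"
  shows "hmg h n q (h c * y) y = h (poly q c) * y ^ n"
proof -
  interpret comm_hom h by fact
  have "poly q c = (\<Sum>l\<le>n. coeff q l * c ^ l)"
    unfolding poly_altdef using assms(2)
    by (intro sum.mono_neutral_left) (auto simp: coeff_eq_0)
  moreover have "h (coeff q l) * (h c * y) ^ l * y ^ (n - l) = h (coeff q l * c ^ l) * y ^ n"
    if "l \<le> n" for l
  proof -
    have "y ^ l * y ^ (n - l) = y ^ n" using that by (simp flip: power_add)
    then show ?thesis by (simp add: hom_mult hom_power power_mult_distrib mult.assoc)
  qed
  ultimately show ?thesis
    by (simp add: hmg_def hom_sum sum_distrib_right)
qed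

lemma hmg_root_dvd:
  fixes q :: "'a::idom poly"
  assumes "comm_hom h" "degree q \<le> n" "poly q c = 0" "q \<noteq> 0"
  shows "(x - h c * y) dvd hmg h n q x y"
proof -
  obtain s where s: "q = [:- c, 1:] * s" using assms(3) by (auto simp: poly_eq_0_iff_dvd)
  have "s \<noteq> 0" using s assms(4) by auto
  then have "degree q = Suc (degree s)" unfolding s by (subst degree_mult_eq) auto
  then obtain m where "n = Suc m" "degree s \<le> m" using assms(2) by (cases n) auto
  then show ?thesis using hmg_linear_mult[OF assms(1), of s m c x y] by (simp add: s)
qed

lemma hmg_reflect:
  "hmg h (degree q) (reflect_poly q) y x = hmg h (degree q) q x y"
  unfolding hmg_def
  by (rule sum.reindex_bij_witness[of _ "\<lambda>l. degree q - l" "\<lambda>l. degree q - l"])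
    (auto simp: coeff_reflect_poly algebra_simps)

lemma hom_hmg:
  assumes "comm_hom \<psi>"
  shows "\<psi> (hmg h n q x y) = hmg (\<lambda>a. \<psi> (h a)) n q (\<psi> x) (\<psi> y)"
proof -
  interpret comm_hom \<psi> by fact
  show ?thesis by (simp add: hmg_def hom_sum hom_mult hom_power)
qed

text \<open>Comparing top coefficients shows that the ratio \<open>c\<close> of the coefficients of
  \<open>A\<close> and \<open>B\<close> in degree \<open>degree B\<close> is a root of
  \<open>q\<close>. Splitting it off leaves either \<open>A = c B\<close> or a relation with smaller
  \<open>n\<close>.\<close>

lemma hmg_eq_0_imp_le:
  fixes q A B :: "'a::field poly"
  assumes "degree A \<le> degree B" "B \<noteq> 0" "q \<noteq> 0" "degree q \<le> n"
    and "hmg (\<lambda>a. [:a:]) n q A B = 0"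
  shows "\<exists>c. A = smult c B"
  using assms(3-5)
proof (induction n arbitrary: q)
  case 0
  then obtain x where "q = [:x:]" by (metis degree_eq_zeroE le_zero_eq)
  then show ?case using 0 by (simp add: hmg_def)
next
  case (Suc n)
  let ?m = "degree B"
  \<comment> \<open>If \<open>A\<close> has smaller degree than \<open>B\<close>, then
    \<open>c = 0\<close>, and the argument goes through unchanged.\<close>
  define c where "c = coeff A ?m / coeff B ?m"
  have B0: "coeff B ?m \<noteq> 0" using assms(2) by simp
  have "degree_lt (Suc n * ?m) (hmg (\<lambda>a. [:a:]) (Suc n) q A B)
    (hmg (\<lambda>a. a) (Suc n) q (coeff A ?m) (coeff B ?m))"
    unfolding hmg_def
  proof (rule degree_lt.lt_sum)
    fix l assume l: "l \<in> {..Suc n}"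
    have "degree_lt (0 + l * ?m + (Suc n - l) * ?m) ([:coeff q l:] * A ^ l * B ^ (Suc n - l))
       (coeff q l * coeff A ?m ^ l * coeff B ?m ^ (Suc n - l))"
      using assms(1)
      by (intro degree_lt.lt_mult degree_lt.lt_power[unfolded of_nat_id])
        (auto simp: degree_lt_def)
    moreover have "0 + l * ?m + (Suc n - l) * ?m = Suc n * ?m"
      using l by (metis add_0 add_mult_distrib atMost_iff le_add_diff_inverse)
    ultimately show "degree_lt (Suc n * ?m) ([:coeff q l:] * A ^ l * B ^ (Suc n - l))
       (coeff q l * coeff A ?m ^ l * coeff B ?m ^ (Suc n - l))" by simp
  qed
  then have "hmg (\<lambda>a. a) (Suc n) q (coeff A ?m) (coeff B ?m) = 0"
    by (simp add: Suc.prems degree_lt_def)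
  moreover have "comm_hom (\<lambda>a :: 'a. a)" by unfold_locales auto
  ultimately have "poly q c * coeff B ?m ^ Suc n = 0"
    using hmg_scale[of "\<lambda>a. a" q "Suc n" c "coeff B ?m"] Suc.prems B0 by (simp add: c_def)
  then have "poly q c = 0" using B0 by simp
  then obtain s where s: "q = [:- c, 1:] * s" by (auto simp: poly_eq_0_iff_dvd)
  have s0: "s \<noteq> 0" using s Suc.prems by auto
  then have "degree q = Suc (degree s)" unfolding s by (subst degree_mult_eq) auto
  then have "degree s \<le> n" using Suc.prems by simp
  then have "(A - [:c:] * B) * hmg (\<lambda>a. [:a:]) n s A B = 0"
    using Suc.prems hmg_linear_mult[OF comm_hom_const_poly, of s n c A B] by (simp add: s)
  then show ?case using Suc.IH[OF s0 \<open>degree s \<le> n\<close>] by auto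
qed

text \<open>Reversing the coefficients of \<open>q\<close> swaps \<open>A\<close> and
  \<open>B\<close>, so one may assume \<open>degree A \<le> degree B\<close>.\<close>

lemma hmg_eq_0_imp:
  fixes q A B :: "'a::field poly"
  assumes "A \<noteq> 0" "B \<noteq> 0" "q \<noteq> 0" "hmg (\<lambda>a. [:a:]) (degree q) q A B = 0"
  obtains c where "c \<noteq> 0" "A = smult c B" "poly q c = 0"
proof -
  have "\<exists>c. A = smult c B"
  proof (cases "degree A \<le> degree B")
    case True
    then show ?thesis using hmg_eq_0_imp_le[of A B q] assms by auto
  next
    case False
    have "reflect_poly q \<noteq> 0" using assms by simp
    moreover have "hmg (\<lambda>a. [:a:]) (degree q) (reflect_poly q) B A = 0"
      using assms by (simp add: hmg_reflect)
    ultimately obtain c where c: "B = smult c A"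
      using hmg_eq_0_imp_le[of B A "reflect_poly q"] False assms degree_reflect_poly_le[of q] by auto
    then have "A = smult (1 / c) B" using assms by auto
    then show ?thesis by blast
  qed
  then obtain c where c: "A = smult c B" by blast
  have "c \<noteq> 0" using c assms by auto
  moreover have "poly q c = 0"
    using assms hmg_scale[OF comm_hom_const_poly, of q "degree q" c B] by (simp add: c)
  ultimately show ?thesis using c that by blast
qed

text \<open>As \<open>a\<close> and \<open>b\<close> are coprime, exponent pairs on the line
  \<open>i * b + j * a = D\<close> differ by multiples of \<open>(a, -b)\<close>. Read from the pair
  with the least exponent of \<open>X1\<close>, the coefficients along the line form
  \<open>q\<close>.\<close>

lemma weighted_homogeneous_hmg:
  fixes Q :: "'a::comm_ring_1 poly poly"
  assumes "Q \<noteq> 0" "0 < a" "0 < b" "coprime a b"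
    and line: "\<And>i j. coeff (coeff Q j) i \<noteq> 0 \<Longrightarrow> i * b + j * a = D"
  obtains q i0 j1 where "q \<noteq> 0"
    "Q = X1 ^ i0 * X2 ^ j1 * hmg const2 (degree q) q (X1 ^ a) (X2 ^ b)"
proof -
  define i0 where "i0 = Min (fst ` mon2 Q)"
  have "fst ` mon2 Q \<noteq> {}" using assms(1) by (simp add: mon2_eq_empty_iff)
  then have "i0 \<in> fst ` mon2 Q" unfolding i0_def by (intro Min_in) auto
  then obtain j0 where ij0: "(i0, j0) \<in> mon2 Q" by auto
  have i0_le: "i0 \<le> i" if "(i, j) \<in> mon2 Q" for i j
    using that unfolding i0_def by (force intro: Min_le)
  \<comment> \<open>Without the guard, truncated subtraction would read a coefficient at
    \<open>X2\<close>-exponent \<open>0\<close>.\<close>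
  define e where "e l = (if b * l \<le> j0 then coeff (coeff Q (j0 - b * l)) (i0 + a * l) else 0)" for l
  define q where "q = (\<Sum>l\<le>j0. monom (e l) l)"
  have q: "coeff q l = e l" for l
  proof -
    have "l \<le> b * l" using assms(3) by simp
    then have "e l = 0" if "\<not> l \<le> j0"
    proof -
      have "\<not> b * l \<le> j0" using that \<open>l \<le> b * l\<close> by linarith
      then show ?thesis by (simp add: e_def)
    qed
    then show ?thesis by (auto simp: q_def coeff_sum)
  qed
  have "coeff q 0 \<noteq> 0" unfolding q e_def using ij0 by (simp add: mon2_def)
  then have q0: "q \<noteq> 0" by auto
  define n where "n = degree q"
  have "e n \<noteq> 0" using q0 by (simp add: n_def flip: q)
  then have n: "b * n \<le> j0" by (auto simp: e_def split: if_splits)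
  have param: "\<exists>l. i = i0 + a * l \<and> j0 = j + b * l" if ij: "(i, j) \<in> mon2 Q" for i j
  proof -
    have "i * b + j * a = D" "i0 * b + j0 * a = D" using ij ij0 by (auto simp: mon2_def line)
    moreover obtain r where r: "i = i0 + r" using i0_le[OF ij] le_Suc_ex by blast
    ultimately have *: "r * b + j * a = j0 * a" by (simp add: algebra_simps)
    then have "a dvd r * b + j * a" by simp
    then have "a dvd r * b" by (simp add: dvd_add_left_iff)
    then obtain l where l: "r = a * l"
      using assms(4) by (auto simp: coprime_dvd_mult_left_iff)
    have "a * (b * l + j) = a * j0" using * by (simp add: l algebra_simps)
    then have "j0 = j + b * l" using assms(2) by simp
    then show ?thesis using r l by auto
  qed
  have "Q = (\<Sum>(i, j)\<in>mon2 Q. const2 (coeff (coeff Q j) i) * X1 ^ i * X2 ^ j)"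
    using eval2_sum[OF comm_hom_const2, of X1 X2 Q] by (simp only: eval2_X1_X2)
  also have "\<dots> = (\<Sum>l | coeff q l \<noteq> 0. const2 (coeff q l) * X1 ^ (i0 + a * l) * X2 ^ (j0 - b * l))"
  proof (rule sum.reindex_bij_witness[of _ "\<lambda>l. (i0 + a * l, j0 - b * l)" "\<lambda>(i, j). (i - i0) div a"])
    fix x assume "x \<in> mon2 Q"
    then obtain i j l where x: "x = (i, j)" "i = i0 + a * l" "j0 = j + b * l" "coeff (coeff Q j) i \<noteq> 0"
      using param by (cases x) (fastforce simp: mon2_def)
    have l: "(i - i0) div a = l" using x assms(2) by simp
    show "(\<lambda>l. (i0 + a * l, j0 - b * l)) ((\<lambda>(i, j). (i - i0) div a) x) = x"
      "(\<lambda>(i, j). (i - i0) div a) x \<in> {l. coeff q l \<noteq> 0}"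
      "const2 (coeff q ((\<lambda>(i, j). (i - i0) div a) x)) * X1 ^ (i0 + a * ((\<lambda>(i, j). (i - i0) div a) x)) *
        X2 ^ (j0 - b * ((\<lambda>(i, j). (i - i0) div a) x)) =
        (case x of (i, j) \<Rightarrow> const2 (coeff (coeff Q j) i) * X1 ^ i * X2 ^ j)"
      using x assms(2) by (simp_all add: q e_def)
  next
    fix l assume "l \<in> {l. coeff q l \<noteq> 0}"
    then show "(\<lambda>(i, j). (i - i0) div a) (i0 + a * l, j0 - b * l) = l"
      "(i0 + a * l, j0 - b * l) \<in> mon2 Q"
      using assms(2) by (auto simp: q e_def mon2_def split: if_splits)
  qed
  also have "\<dots> = (\<Sum>l\<le>n. const2 (coeff q l) * X1 ^ (i0 + a * l) * X2 ^ (j0 - b * l))"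
    by (rule sum.mono_neutral_left) (auto simp: n_def le_degree const2_hom)
  also have "\<dots> = (\<Sum>l\<le>n. X1 ^ i0 * X2 ^ (j0 - b * n) *
      (const2 (coeff q l) * (X1 ^ a) ^ l * (X2 ^ b) ^ (n - l)))"
  proof (rule sum.cong)
    fix l assume "l \<in> {..n}"
    then obtain k where k: "n = l + k" by (metis atMost_iff le_Suc_ex)
    then have "j0 - b * l = (j0 - b * n) + b * (n - l)" using n by (simp add: algebra_simps)
    then show "const2 (coeff q l) * X1 ^ (i0 + a * l) * X2 ^ (j0 - b * l) =
      X1 ^ i0 * X2 ^ (j0 - b * n) * (const2 (coeff q l) * (X1 ^ a) ^ l * (X2 ^ b) ^ (n - l))"
      by (simp only: power_add power_mult mult_ac)
  qed simp
  also have "\<dots> = X1 ^ i0 * X2 ^ (j0 - b * n) * hmg const2 n q (X1 ^ a) (X2 ^ b)"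
    by (simp add: hmg_def sum_distrib_left)
  finally show ?thesis using that q0 by (simp add: n_def)
qed

text \<open>The monomial factor of \<open>Q\<close> does not vanish at
  \<open>(\<alpha>, \<beta>)\<close>, so the form in \<open>X1 ^ a\<close> and \<open>X2 ^ b\<close>
  does. The resulting root \<open>c\<close> yields both the relation and the divisor.\<close>

lemma weighted_homogeneous_vanishing:
  fixes Q :: "'a::field poly poly"
  assumes "Q \<noteq> 0" "0 < a" "0 < b" "coprime a b"
    and "\<And>i j. coeff (coeff Q j) i \<noteq> 0 \<Longrightarrow> i * b + j * a = D"
    and "\<alpha> \<noteq> 0" "\<beta> \<noteq> 0" "eval2 (\<lambda>a. [:a:]) \<alpha> \<beta> Q = 0"
  obtains c where "c \<noteq> 0" "\<alpha> ^ a = smult c (\<beta> ^ b)" "X1 ^ a - const2 c * X2 ^ b dvd Q"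
proof -
  obtain q i0 j1 where q: "q \<noteq> 0"
    and Q: "Q = X1 ^ i0 * X2 ^ j1 * hmg const2 (degree q) q (X1 ^ a) (X2 ^ b)"
    using weighted_homogeneous_hmg[OF assms(1-5)] by blast
  let ?e = "eval2 (\<lambda>a. [:a:]) \<alpha> \<beta>"
  interpret comm_hom ?e by (intro comm_hom_eval2 comm_hom_const_poly)
  have "hmg (\<lambda>a. [:a:]) (degree q) q (\<alpha> ^ a) (\<beta> ^ b) = 0"
    using assms(6-8)
    by (simp add: Q hom_mult hom_power hom_hmg[OF comm_hom_axioms] comm_hom_const_poly)
  then obtain c where c: "c \<noteq> 0" "\<alpha> ^ a = smult c (\<beta> ^ b)" "poly q c = 0"
    using hmg_eq_0_imp[of "\<alpha> ^ a" "\<beta> ^ b" q] assms(6,7) q by auto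
  have "X1 ^ a - const2 c * X2 ^ b dvd Q" unfolding Q
    using hmg_root_dvd[OF comm_hom_const2 order_refl c(3) q] by (intro dvd_mult)
  then show ?thesis using c that by blast
qed

section \<open>Derivations and flows on cusps\<close>

lemma map_poly_derivation:
  fixes \<delta> :: "'r::comm_ring_1 \<Rightarrow> 'r"
  assumes add: "\<And>x y. \<delta> (x + y) = \<delta> x + \<delta> y" and mult: "\<And>x y. \<delta> (x * y) = x * \<delta> y + \<delta> x * y"
  shows "map_poly \<delta> (p + q) = map_poly \<delta> p + map_poly \<delta> q"
    and "map_poly \<delta> (p * q) = p * map_poly \<delta> q + map_poly \<delta> p * q"
proof -
  have 0: "\<delta> 0 = 0" using add[of 0 0] by simp
  have sum: "\<delta> (\<Sum>i\<in>I. f i) = (\<Sum>i\<in>I. \<delta> (f i))" for I :: "nat set" and f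
    by (induction I rule: infinite_finite_induct) (simp_all add: 0 add)
  show "map_poly \<delta> (p + q) = map_poly \<delta> p + map_poly \<delta> q"
    by (rule poly_eqI) (simp add: coeff_map_poly 0 add)
  show "map_poly \<delta> (p * q) = p * map_poly \<delta> q + map_poly \<delta> p * q"
    by (rule poly_eqI) (simp add: coeff_map_poly 0 coeff_mult sum mult sum.distrib)
qed

lemma derivation_power:
  fixes \<delta> :: "'r::comm_ring_1 \<Rightarrow> 'r"
  assumes mult: "\<And>x y. \<delta> (x * y) = x * \<delta> y + \<delta> x * y"
  shows "\<delta> (x ^ Suc n) = of_nat (Suc n) * x ^ n * \<delta> x"
proof (induction n)
  case 0
  have "\<delta> 1 = 0" using mult[of 1 1] by (metis add_cancel_right_right mult_1 mult_1_right)
  then show ?case by simp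
next
  case (Suc n)
  have "\<delta> (x ^ Suc (Suc n)) = x * \<delta> (x ^ Suc n) + \<delta> x * x ^ Suc n"
    by (simp only: power_Suc[of x "Suc n"] mult)
  also have "\<dots> = of_nat (Suc (Suc n)) * x ^ Suc n * \<delta> x"
    unfolding Suc.IH by (simp add: algebra_simps)
  finally show ?case .
qed

text \<open>
  Apply \<open>\<delta>\<close> to \<open>U\<^sup>a - c V\<^sup>b = P\<close>, multiply by \<open>U\<close> and eliminate \<open>U\<^sup>a\<close>:
  \<open>c V\<^sup>b\<^sup>-\<^sup>1 (a V \<delta>U - b U \<delta>V) = a (u\<^sup>a\<^sup>-\<^sup>1 U - P \<delta>U)\<close>. The value of the right-hand side at \<open>0\<close> is
  \<open>a c v\<^sup>b \<noteq> 0\<close>, so \<open>(b - 1) deg V \<le> deg U\<close>, which contradicts \<open>a deg U = b deg V\<close> unless both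
  degrees vanish. In a field of positive characteristic one of the
  coprime numbers \<open>a, b\<close> may vanish, but not both, so that this applies to \<open>U, V\<close> or to \<open>V, U\<close>.
\<close>

lemma cusp_flow_degree_0:
  fixes U V :: "'r::idom poly" and \<delta> :: "'r \<Rightarrow> 'r"
  assumes add: "\<And>x y. \<delta> (x + y) = \<delta> x + \<delta> y" and mult: "\<And>x y. \<delta> (x * y) = x * \<delta> y + \<delta> x * y"
    and uv: "\<delta> u = 1" "\<delta> v = 0" "\<delta> c = 0" "poly U 0 = u" "poly V 0 = v" "c \<noteq> 0" "v \<noteq> 0"
    and ab: "of_nat a \<noteq> (0 :: 'r)" "2 \<le> a" "2 \<le> b" "coprime a b"
    and eq: "U ^ a - smult c (V ^ b) = [:u ^ a - c * v ^ b:]"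
  shows "degree U = 0" "degree V = 0"
proof -
  obtain a' where a: "a = Suc a'" using ab by (cases a) auto
  obtain b' where b: "b = Suc b'" using ab by (cases b) auto
  \<comment> \<open>\<open>?d\<close> differentiates coefficients and treats the polynomial
    variable, the flow parameter, as a constant.\<close>
  let ?d = "map_poly \<delta>" and ?P = "[:u ^ a - c * v ^ b:]"
  note d_add = map_poly_derivation(1)[of \<delta>, OF add mult]
  note d_mult = map_poly_derivation(2)[of \<delta>, OF add mult]
  note \<delta>_pow = derivation_power[of \<delta>, OF mult]
  note d_pow = derivation_power[of ?d, OF d_mult]
  have Ua: "U ^ a = ?P + smult c (V ^ b)" using eq by (simp add: algebra_simps)
  have \<delta>0: "\<delta> 0 = 0" using add[of 0 0] by (metis add_0 add_cancel_right_right)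
  have \<delta>minus: "\<delta> (x - y) = \<delta> x - \<delta> y" for x y using add[of "x - y" y] by simp
  have dC: "?d [:x:] = [:\<delta> x:]" for x by (simp add: map_poly_pCons \<delta>0)
  have dV: "?d (smult c (V ^ b)) = smult c (of_nat b * V ^ b' * ?d V)"
    using d_mult[of "[:c:]" "V ^ b"] by (simp add: dC uv b d_pow del: power_Suc of_nat_Suc)
  have "?d (U ^ a) = ?d ?P + ?d (smult c (V ^ b))" unfolding Ua d_add ..
  moreover have "\<delta> (u ^ a - c * v ^ b) = of_nat a * u ^ a'"
    unfolding \<delta>minus mult a b \<delta>_pow using uv by simp
  ultimately have "of_nat a * U ^ a' * ?d U = [:of_nat a * u ^ a':] + smult c (of_nat b * V ^ b' * ?d V)"
    unfolding dV by (simp add: dC a d_pow del: power_Suc of_nat_Suc)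
  then have "U * (of_nat a * U ^ a' * ?d U) = U * ([:of_nat a * u ^ a':] + smult c (of_nat b * V ^ b' * ?d V))"
    by (rule arg_cong)
  then have "of_nat a * ?d U * U ^ a = U * ([:of_nat a * u ^ a':] + [:c:] * (of_nat b * V ^ b' * ?d V))"
    by (simp add: a algebra_simps)
  moreover have "U ^ a = ?P + [:c:] * (V * V ^ b')" using Ua by (simp add: b)
  ultimately have key: "V ^ b' * ([:c:] * (of_nat a * V * ?d U - of_nat b * U * ?d V)) =
      [:of_nat a * u ^ a':] * U - of_nat a * ?P * ?d U" (is "?l = ?r")
    by (simp only: algebra_simps)
  have "poly ?r 0 = of_nat a * (c * v ^ b)"
    by (simp add: poly_0_coeff_0 coeff_map_poly \<delta>0 uv[folded poly_0_coeff_0] a flip: poly_0_coeff_0)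
      (use uv in \<open>simp add: poly_0_coeff_0 coeff_map_poly \<delta>0 algebra_simps\<close>)
  moreover have "of_nat a * (c * v ^ b) \<noteq> 0" using ab uv by simp
  ultimately have r0: "?r \<noteq> 0" by (metis poly_0)
  have deg_r: "degree ?r \<le> degree U"
  proof (rule degree_diff_le)
    show "degree ([:of_nat a * u ^ a':] * U) \<le> degree U" by simp
    have "of_nat a * ?P * ?d U = smult (of_nat a * (u ^ a - c * v ^ b)) (?d U)"
      by (simp add: of_nat_poly mult.commute)
    then show "degree (of_nat a * ?P * ?d U) \<le> degree U"
      using map_poly_degree_leq[of \<delta> U] degree_smult_le order_trans by metis
  qed
  have "degree (V ^ b') \<le> degree ?l" using r0 unfolding key[symmetric]
    by (intro degree_mult_right_le) auto
  also have "\<dots> \<le> degree U" unfolding key by (rule deg_r)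
  finally have le0: "degree (V ^ b') \<le> degree U" .
  have "V \<noteq> 0" using uv by auto
  then have le: "b' * degree V \<le> degree U" using le0 by (simp add: degree_power_eq)
  have "degree (U ^ a) \<le> degree (V ^ b)" unfolding Ua using uv by (intro degree_add_le) auto
  moreover have "degree (U ^ a) = a * degree U"
    using ab by (cases "U = 0") (auto simp: degree_power_eq power_0_left)
  moreover have "degree (V ^ b) = b * degree V" using \<open>V \<noteq> 0\<close> by (simp add: degree_power_eq)
  ultimately have le2: "a * degree U \<le> b * degree V" by simp
  show "degree V = 0"
  proof (rule ccontr)
    assume V: "degree V \<noteq> 0"
    \<comment> \<open>\<open>a * (b - 1) \<le> b\<close> with \<open>a, b \<ge> 2\<close> leaves
      only \<open>a = b = 2\<close>, which is not a coprime pair.\<close>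
    have "a * (b' * degree V) \<le> b * degree V" using le le2 mult_le_mono2 order_trans by blast
    then have "(a * b') * degree V \<le> Suc b' * degree V" by (simp only: b mult.assoc)
    then have *: "a * b' \<le> Suc b'" using V by (simp only: mult_le_cancel2)
    have "2 * b' \<le> a * b'" using ab by simp
    then have "b' = 1" using * ab b by linarith
    then have "a = 2" "b = 2" using * ab b by auto
    then show False using ab by simp
  qed
  then show "degree U = 0" using le2 ab by simp
qed

lemma pderiv_derivation: "pderiv (x * y) = x * pderiv y + pderiv x * y"
  by (simp add: pderiv_mult mult.commute)

text \<open>If \<open>a\<close> is nonzero in the field, differentiate by the inner variable
  \<open>x1\<close>, that is, by \<open>map_poly pderiv\<close>. Otherwise \<open>b\<close> is
  nonzero by coprimality; multiplying the equation by \<open>-1/c\<close> exchanges the roles, and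
  \<open>pderiv\<close> differentiates by \<open>x2\<close>.\<close>

lemma cusp_flow_degree_0_field:
  fixes U V :: "'a::field poly poly poly"
  assumes U: "poly U 0 = X1" and V: "poly V 0 = X2" and c: "c \<noteq> 0"
    and ab: "2 \<le> a" "2 \<le> b" "coprime a b"
    and eq: "U ^ a - smult (const2 c) (V ^ b) = [:X1 ^ a - const2 c * X2 ^ b:]"
  shows "degree U = 0" "degree V = 0"
proof -
  have X: "X1 \<noteq> (0 :: 'a poly poly)" "X2 \<noteq> (0 :: 'a poly poly)"
    by (simp_all add: X1_def X2_def)
  have c2: "const2 x \<noteq> 0" if "x \<noteq> 0" for x :: 'a using that by (simp add: const2_def)
  have "degree U = 0 \<and> degree V = 0"
  proof (cases "of_nat a = (0 :: 'a)")
    case False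
    have "of_nat a \<noteq> (0 :: 'a poly poly)" using False by (simp add: of_nat_eq_0_iff_char_dvd)
    moreover have "map_poly pderiv X1 = (1 :: 'a poly poly)"
      "map_poly pderiv X2 = (0 :: 'a poly poly)" "map_poly pderiv (const2 c) = 0"
      by (simp_all add: X1_def X2_def const2_def map_poly_pCons pderiv_pCons one_pCons)
    ultimately show ?thesis
      using cusp_flow_degree_0[of "map_poly pderiv" X1 X2 "const2 c" U V a b,
          OF map_poly_derivation[of pderiv, OF pderiv_add pderiv_derivation]] assms X c2[OF c]
      by blast
  next
    case True
    then have "CHAR('a) dvd a" by (simp add: of_nat_eq_0_iff_char_dvd)
    moreover have "\<not> CHAR('a) dvd 1" using of_nat_eq_0_iff_char_dvd[where 'a='a, of 1] by simp
    ultimately have "\<not> CHAR('a) dvd b" using ab(3) by (meson coprime_common_divisor)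
    then have b: "of_nat b \<noteq> (0 :: 'a poly poly)" by (simp add: of_nat_eq_0_iff_char_dvd)
    have c': "const2 (- inverse c) * const2 c = - 1" "const2 (- inverse c) = - const2 (inverse c)"
      using c by (simp_all add: const2_def one_pCons)
    have "smult (const2 (- inverse c)) (U ^ a - smult (const2 c) (V ^ b)) =
      smult (const2 (- inverse c)) [:X1 ^ a - const2 c * X2 ^ b:]" unfolding eq ..
    then have "smult (const2 (- inverse c)) (U ^ a) - smult (const2 (- inverse c) * const2 c) (V ^ b) =
      [:const2 (- inverse c) * X1 ^ a - (const2 (- inverse c) * const2 c) * X2 ^ b:]"
      by (simp add: smult_diff_right algebra_simps)
    then have "V ^ b - smult (const2 (inverse c)) (U ^ a) = [:X2 ^ b - const2 (inverse c) * X1 ^ a:]"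
      unfolding c'(1) by (simp add: c'(2))
    moreover have "pderiv X2 = (1 :: 'a poly poly)"
      "pderiv X1 = (0 :: 'a poly poly)" "pderiv (const2 (inverse c)) = 0"
      by (simp_all add: X1_def X2_def const2_def pderiv_pCons one_pCons)
    moreover have "const2 (inverse c) \<noteq> 0" using c by (intro c2) simp
    ultimately have "degree V = 0 \<and> degree U = 0"
      using cusp_flow_degree_0[of pderiv X2 X1 "const2 (inverse c)" V U b a,
          OF pderiv_add pderiv_derivation] assms X b coprime_commute by blast
    then show ?thesis by simp
  qed
  then show "degree U = 0" "degree V = 0" by auto
qed

subsection \<open>Leading coefficients of an automorphism\<close>

lemma coeff_X1: "coeff (coeff X1 j) i = (if i = 1 \<and> j = 0 then 1 else 0)"
  by (auto simp: X1_def coeff_pCons split: nat.split)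

lemma coeff_X2: "coeff (coeff X2 j) i = (if i = 0 \<and> j = 1 then 1 else 0)"
  by (auto simp: X2_def coeff_pCons one_pCons split: nat.split)

lemma poly2_eqI: "(\<And>i j. coeff (coeff p j) i = coeff (coeff q j) i) \<Longrightarrow> p = q"
  by (simp add: poly_eq_iff)

lemma wpart_X1 [simp]: "wpart e1 e2 e1 X1 = X1"
  by (rule poly2_eqI) (simp add: coeff_wpart coeff_X1)

lemma wpart_X2 [simp]: "wpart e1 e2 e2 X2 = X2"
  by (rule poly2_eqI) (simp add: coeff_wpart coeff_X2)

lemma wpart_scale:
  assumes "0 < N"
  shows "wpart (int N * int d1) (int N * int d2) (int N * int D) q = wpart d1 d2 D q"
proof (rule poly2_eqI)
  fix i j
  have "int i * (int N * int d1) + int j * (int N * int d2) = int N * int (i * d1 + j * d2)"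
    by (simp add: algebra_simps)
  then have "int i * (int N * int d1) + int j * (int N * int d2) = int N * int D \<longleftrightarrow> i * d1 + j * d2 = D"
    using assms by (simp only: mult_cancel_left of_nat_eq_iff of_nat_eq_0_iff) auto
  then show "coeff (coeff (wpart (int N * int d1) (int N * int d2) (int N * int D) q) j) i =
      coeff (coeff (wpart d1 d2 D q) j) i"
    by (simp add: coeff_wpart)
qed

text \<open>The least ratio \<open>e / k\<close>, stated by cross multiplication so that weights
  stay integral.\<close>

lemma ex_min_ratio:
  fixes S :: "(int \<times> nat) set"
  assumes "finite S" "S \<noteq> {}" "\<And>e k. (e, k) \<in> S \<Longrightarrow> 0 < k"
  shows "\<exists>m N. (m, N) \<in> S \<and> (\<forall>(e, k)\<in>S. m * int k \<le> e * int N)"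
proof -
  define r :: "int \<times> nat \<Rightarrow> rat" where "r x = of_int (fst x) / of_nat (snd x)" for x
  have "Min (r ` S) \<in> r ` S" using assms by (intro Min_in) auto
  then obtain m N where mN: "(m, N) \<in> S" "r (m, N) = Min (r ` S)" by (metis imageE surj_pair)
  have "m * int k \<le> e * int N" if ek: "(e, k) \<in> S" for e k
  proof -
    have "r (m, N) \<le> r (e, k)" unfolding mN(2) using assms(1) ek by (intro Min_le) auto
    then have "of_int m * (of_nat k :: rat) \<le> of_int e * of_nat N"
      using assms(3)[OF mN(1)] assms(3)[OF ek] by (simp add: r_def field_simps)
    then have "of_int (m * int k) \<le> (of_int (e * int N) :: rat)" by simp
    then show ?thesis by (simp only: of_int_le_iff)
  qed
  then show ?thesis using mN(1) by blast
qed

lemma fls_lt_scaled_const: "fls_lt w (fls_const c * fls_X_intpow (- w)) c"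
  using fls_lt.lt_mult[OF fls_lt_const fls_lt_X_intpow[of w], of c] by simp

text \<open>
  The flow is \<open>f(F, G + T), g(F, G + T)\<close>. The weight \<open>m / N\<close> of \<open>T\<close> is the largest one for which
  the flow does not raise weights; all weights are multiplied by \<open>N\<close> to stay integral, and \<open>m\<close>
  may be negative.
\<close>

lemma leading_flow:
  fixes f g F G :: "'a::field poly poly" and d1 d2 D :: nat
  assumes fgF: "endo2 f g F = X1" and fgG: "endo2 f g G = X2"
    and FGf: "endo2 F G f = X1" and FGg: "endo2 F G g = X2"
    and D: "\<And>i j. coeff (coeff F j) i \<noteq> 0 \<Longrightarrow> i * d1 + j * d2 \<le> D"
  obtains U V where "poly U 0 = X1" "poly V 0 = X2" "degree U \<noteq> 0 \<or> degree V \<noteq> 0"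
    "eval2 (\<lambda>a. [:const2 a:]) U V (wpart d1 d2 D F) = [:wpart d1 d2 D F:]"
proof -
  define hB :: "'a \<Rightarrow> 'a poly poly poly" where "hB a = [:const2 a:]" for a
  have hB: "comm_hom hB"
    unfolding hB_def by (intro comm_hom_comp[OF comm_hom_const_poly comm_hom_const2])
  \<comment> \<open>\<open>\<psi>\<close> sends \<open>q\<close> to \<open>q(F, G + T)\<close>, with
    \<open>T\<close> the new outermost variable.\<close>
  define \<psi> where "\<psi> = eval2 hB [:F:] [:G, 1:]"
  have \<psi>: "comm_hom \<psi>" unfolding \<psi>_def by (intro comm_hom_eval2 hB)
  define U where "U = \<psi> f"
  define V where "V = \<psi> g"
  have "poly (\<psi> q) 0 = endo2 F G q" for q
  proof -
    have "comm_hom (\<lambda>p :: 'a poly poly poly. poly p 0)" by unfold_locales simp_all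
    from hom_eval2[OF this hB] show ?thesis by (simp add: \<psi>_def hB_def endo2_eval2)
  qed
  then have U0: "poly U 0 = X1" and V0: "poly V 0 = X2" by (simp_all add: U_def V_def FGf FGg)
  \<comment> \<open>Evaluation at \<open>(U, V)\<close> is \<open>\<psi>\<close> after
    \<open>endo2 f g\<close>, so it sends \<open>F\<close> to \<open>F\<close> and \<open>G\<close>
    to \<open>G + T\<close>; the latter shows that \<open>U, V\<close> cannot both be free of
    \<open>T\<close>.\<close>
  have UV: "eval2 hB U V q = \<psi> (endo2 f g q)" for q
    unfolding endo2_eval2 hom_eval2[OF \<psi> comm_hom_const2] by (simp add: U_def V_def \<psi>_def hB)
  have UVF: "eval2 hB U V F = [:F:]" and UVG: "eval2 hB U V G = [:G, 1:]"
    by (simp_all add: UV fgF fgG \<psi>_def hB)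
  have emb: "eval2 hB [:X1:] [:X2:] q = [:q:]" for q
    using hom_eval2[OF comm_hom_const_poly comm_hom_const2, of X1 X2 q]
    by (simp add: eval2_X1_X2 hB_def[abs_def])
  have "degree U \<noteq> 0 \<or> degree V \<noteq> 0"
  proof (rule ccontr)
    assume "\<not> ?thesis"
    then have "U = [:X1:]" "V = [:X2:]" using U0 V0 by (auto elim!: degree_eq_zeroE)
    then show False using UVG emb[of G] by simp
  qed

  \<comment> \<open>A monomial of weight \<open>w\<close> at \<open>T ^ k\<close> stays within
    weight \<open>d\<close> iff the weight of \<open>T\<close> is at most
    \<open>(d - w) / k\<close>. \<open>S W d\<close> collects the pairs \<open>(d - w, k)\<close>
    with \<open>k > 0\<close>.\<close>
  define S where "S W d = (\<lambda>(k, i, j). (int d - int (i * d1 + j * d2), k)) `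
      (SIGMA k:{1..degree W}. mon2 (coeff W k))" for W :: "'a poly poly poly" and d
  have S_I: "(int d - int (i * d1 + j * d2), k) \<in> S W d"
    if "0 < k" "coeff (coeff (coeff W k) j) i \<noteq> 0" for W k i j d
  proof -
    have "k \<le> degree W" using that by (intro le_degree) auto
    then show ?thesis using that unfolding S_def
      by (intro image_eqI[of _ _ "(k, i, j)"]) (auto simp: mon2_def)
  qed
  have S_E: "\<exists>i j. 0 < k \<and> coeff (coeff (coeff W k) j) i \<noteq> 0 \<and> e = int d - int (i * d1 + j * d2)"
    if "(e, k) \<in> S W d" for e k W d
    using that by (auto simp: S_def mon2_def)
  have S_ne: "S W d \<noteq> {}" if "degree W \<noteq> 0" for W d
  proof -
    have "lead_coeff W \<noteq> 0" using that by auto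
    then have "mon2 (lead_coeff W) \<noteq> {}" using mon2_eq_empty_iff by blast
    then obtain i j where "coeff (coeff (lead_coeff W) j) i \<noteq> 0" by (auto simp: mon2_def)
    then have "(int d - int (i * d1 + j * d2), degree W) \<in> S W d" using that by (intro S_I) auto
    then show ?thesis by auto
  qed
  have "finite (S W d)" for W d unfolding S_def by (intro finite_imageI finite_SigmaI) auto
  then have "finite (S U d1 \<union> S V d2)" by simp
  moreover have "S U d1 \<union> S V d2 \<noteq> {}"
    using S_ne[of U d1] S_ne[of V d2] \<open>degree U \<noteq> 0 \<or> degree V \<noteq> 0\<close> by auto
  moreover have pos: "0 < k" if "(e, k) \<in> S U d1 \<union> S V d2" for e k
    using that S_E[of e k U d1] S_E[of e k V d2] by auto
  ultimately have "\<exists>m N. (m, N) \<in> S U d1 \<union> S V d2 \<and>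
      (\<forall>(e, k)\<in>S U d1 \<union> S V d2. m * int k \<le> e * int N)"
    by (rule ex_min_ratio)
  then obtain m N where mN: "(m, N) \<in> S U d1 \<union> S V d2"
    and min': "\<forall>(e, k)\<in>S U d1 \<union> S V d2. m * int k \<le> e * int N"
    by (elim exE conjE)
  have min: "m * int k \<le> e * int N" if "(e, k) \<in> S U d1 \<union> S V d2" for e k
    using bspec[OF min' that] by simp
  have N: "0 < N" using mN by (rule pos)

  define e1 where "e1 = int N * int d1"
  define e2 where "e2 = int N * int d2"
  \<comment> \<open>Multiplying the variables by powers of the Laurent variable turns weight into
    pole order; \<open>T\<close> receives pole order \<open>m\<close> in the same way.\<close>
  define \<rho>A where "\<rho>A = eval2 (\<lambda>a. fls_const (hB a))
    (fls_const [:X1:] * fls_X_intpow (- e1)) (fls_const [:X2:] * fls_X_intpow (- e2))"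
  have hL: "comm_hom (\<lambda>a. fls_const (hB a))"
    by (rule comm_hom_comp[OF _ hB]) (unfold_locales, simp_all add: fls_plus_const fls_const_mult_const)
  have \<rho>A: "comm_hom \<rho>A" unfolding \<rho>A_def by (intro comm_hom_eval2 hL)
  define T where "T = fls_const [:0, 1 :: 'a poly poly:] * fls_X_intpow (- m)"
  define \<rho> where "\<rho> W = poly (map_poly \<rho>A W) T" for W
  have \<rho>: "comm_hom \<rho>" unfolding \<rho>_def by (intro comm_hom.comm_hom_poly_map_poly \<rho>A)
  have \<rho>_const: "\<rho> [:q:] = \<rho>A q" for q
    using comm_hom.hom_zero[OF \<rho>A] by (simp add: \<rho>_def map_poly_pCons)
  have lt_\<rho>A: "fls_lt w (\<rho>A q) [:wpart e1 e2 w q:]"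
    if "\<And>i j. coeff (coeff q j) i \<noteq> 0 \<Longrightarrow> int i * e1 + int j * e2 \<le> w" for w q
    unfolding \<rho>A_def emb[of "wpart e1 e2 w q", symmetric]
    by (rule fls_lt.lt_eval2[OF hL hB fls_lt_const fls_lt_scaled_const fls_lt_scaled_const that])
  \<comment> \<open>The part of \<open>W\<close> of weight \<open>e\<close> when \<open>T\<close>
    has weight \<open>m\<close>.\<close>
  define top where "top e W = (\<Sum>k | coeff W k \<noteq> 0. [:wpart e1 e2 (e - m * int k) (coeff W k):] * [:0, 1:] ^ k)"
    for e and W :: "'a poly poly poly"
  have coeff_top: "coeff (top e W) k = wpart e1 e2 (e - m * int k) (coeff W k)" for e W k
  proof -
    have "coeff (top e W) k =
      (\<Sum>l | coeff W l \<noteq> 0. if l = k then wpart e1 e2 (e - m * int k) (coeff W k) else 0)"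
      unfolding top_def coeff_sum by (rule sum.cong) (auto simp flip: monom_altdef)
    then show ?thesis by (auto simp: wpart_def mon2_def)
  qed
  have lt_\<rho>: "fls_lt e (\<rho> W) (top e W)"
    if "\<And>k i j. coeff (coeff (coeff W k) j) i \<noteq> 0 \<Longrightarrow> int i * e1 + int j * e2 + m * int k \<le> e"
    for e W
    unfolding \<rho>_def comm_hom.poly_map_poly_sum[OF \<rho>A] top_def
  proof (rule fls_lt.lt_sum)
    fix k
    have "fls_lt ((e - m * int k) + int k * m) (\<rho>A (coeff W k) * T ^ k)
        ([:wpart e1 e2 (e - m * int k) (coeff W k):] * [:0, 1:] ^ k)"
      unfolding T_def using that[of k]
      by (intro fls_lt.lt_mult fls_lt.lt_power[unfolded of_int_of_nat_eq] lt_\<rho>A fls_lt_scaled_const) force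
    then show "fls_lt e (\<rho>A (coeff W k) * T ^ k)
        ([:wpart e1 e2 (e - m * int k) (coeff W k):] * [:0, 1:] ^ k)"
      by (simp add: algebra_simps)
  qed
  have le_U: "int i * e1 + int j * e2 + m * int k \<le> e1" if "coeff (coeff (coeff U k) j) i \<noteq> 0" for k i j
  proof (cases k)
    \<comment> \<open>At \<open>T = 0\<close> the flow is the identity, so the only monomial here is
      \<open>X1\<close>, of weight \<open>e1\<close>.\<close>
    case 0
    then show ?thesis using that U0 by (auto simp: poly_0_coeff_0 coeff_X1 split: if_splits)
  next
    case (Suc k')
    then have "m * int k \<le> (int d1 - int (i * d1 + j * d2)) * int N"
      using S_I[OF _ that] by (intro min) auto
    then show ?thesis by (simp add: e1_def e2_def algebra_simps)
  qed
  have le_V: "int i * e1 + int j * e2 + m * int k \<le> e2" if "coeff (coeff (coeff V k) j) i \<noteq> 0" for k i j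
  proof (cases k)
    case 0
    then show ?thesis using that V0 by (auto simp: poly_0_coeff_0 coeff_X2 split: if_splits)
  next
    case (Suc k')
    then have "m * int k \<le> (int d2 - int (i * d1 + j * d2)) * int N"
      using S_I[OF _ that] by (intro min) auto
    then show ?thesis by (simp add: e1_def e2_def algebra_simps)
  qed
  define Ub where "Ub = top e1 U"
  define Vb where "Vb = top e2 V"
  have ltU: "fls_lt e1 (\<rho> U) Ub" and ltV: "fls_lt e2 (\<rho> V) Vb"
    unfolding Ub_def Vb_def by (rule lt_\<rho>, erule le_U, rule lt_\<rho>, erule le_V)
  have "poly Ub 0 = X1" "poly Vb 0 = X2"
    using U0 V0 by (simp_all add: poly_0_coeff_0 Ub_def Vb_def coeff_top)
  moreover have "degree Ub \<noteq> 0 \<or> degree Vb \<noteq> 0"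
  proof -
    \<comment> \<open>The minimal ratio is attained at \<open>(m, N)\<close>, so some monomial at
      \<open>T ^ N\<close> has exactly the top weight and survives.\<close>
    have *: "degree (top (int N * int d) W) \<noteq> 0" if mNW: "(m, N) \<in> S W d" for W d
    proof -
      obtain i j where ij: "coeff (coeff (coeff W N) j) i \<noteq> 0" "m = int d - int (i * d1 + j * d2)"
        using S_E[OF mNW] by blast
      have "int i * e1 + int j * e2 = int N * int d - m * int N"
        by (simp add: ij(2) e1_def e2_def algebra_simps)
      then have "coeff (coeff (coeff (top (int N * int d) W) N) j) i \<noteq> 0"
        using ij(1) by (simp add: coeff_top coeff_wpart)
      then have "N \<le> degree (top (int N * int d) W)" by (intro le_degree) auto
      then show ?thesis using N by simp
    qed
    show ?thesis using mN *[of U d1] *[of V d2] by (auto simp: Ub_def Vb_def e1_def e2_def)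
  qed
  moreover have "eval2 hB Ub Vb (wpart d1 d2 D F) = [:wpart d1 d2 D F:]"
  proof -
    let ?w = "int N * int D"
    have le: "int i * e1 + int j * e2 \<le> ?w" if "coeff (coeff F j) i \<noteq> 0" for i j
    proof -
      have "int N * int (i * d1 + j * d2) \<le> ?w" using D[OF that]
        by (intro mult_left_mono) (simp_all only: of_nat_le_iff of_nat_0_le_iff)
      then show ?thesis by (simp add: e1_def e2_def algebra_simps)
    qed
    \<comment> \<open>The leading term of \<open>\<rho>A F\<close> is found twice: directly, and
      through \<open>F(U, V) = F\<close> from the leading terms of \<open>U\<close> and
      \<open>V\<close>.\<close>
    have "fls_lt ?w (\<rho>A F) [:wpart e1 e2 ?w F:]" using le by (rule lt_\<rho>A)
    moreover have "fls_lt ?w (eval2 (\<lambda>a. fls_const (hB a)) (\<rho> U) (\<rho> V) F) (eval2 hB Ub Vb (wpart e1 e2 ?w F))"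
      by (rule fls_lt.lt_eval2) (use le in \<open>auto intro: hL hB fls_lt_const ltU ltV\<close>)
    moreover have "\<rho>A F = eval2 (\<lambda>a. fls_const (hB a)) (\<rho> U) (\<rho> V) F"
    proof -
      have "\<rho> (hB a) = fls_const (hB a)" for a
        unfolding hB_def \<rho>_const by (simp add: \<rho>A_def hL) (simp add: hB_def)
      then show ?thesis
        using hom_eval2[OF \<rho> hB, of U V F] by (simp add: UVF \<rho>_const)
    qed
    ultimately have "eval2 hB Ub Vb (wpart e1 e2 ?w F) = [:wpart e1 e2 ?w F:]"
      using fls_lt_unique by metis
    then show ?thesis unfolding e1_def e2_def wpart_scale[OF N] .
  qed
  ultimately show ?thesis using that unfolding hB_def by blast
qed

lemma automorphism_lead_coeff:
  fixes f g F G :: "'a::field poly poly"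
  assumes fgF: "endo2 f g F = X1" and fgG: "endo2 f g G = X2"
    and FGf: "endo2 F G f = X1" and FGg: "endo2 F G g = X2"
    and deg: "0 < degree f" "0 < degree g"
  shows "(\<exists>c n. c \<noteq> 0 \<and> 0 < n \<and> degree g = n * degree f \<and> lead_coeff g = smult c (lead_coeff f ^ n)) \<or>
    (\<exists>c n. c \<noteq> 0 \<and> 0 < n \<and> degree f = n * degree g \<and> lead_coeff f = smult c (lead_coeff g ^ n))"
proof -
  define d1 where "d1 = degree f"
  define d2 where "d2 = degree g"
  \<comment> \<open>\<open>a, b\<close> are the least positive exponents for which
    \<open>X1 ^ a\<close> and \<open>X2 ^ b\<close> have equal weight.\<close>
  define a where "a = d2 div gcd d1 d2"
  define b where "b = d1 div gcd d1 d2"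
  have d12: "d1 = b * gcd d1 d2" "d2 = a * gcd d1 d2" by (simp_all add: a_def b_def)
  have d_pos: "0 < d1" "0 < d2" using deg by (simp_all add: d1_def d2_def)
  then have "a \<noteq> 0" "b \<noteq> 0" using d12 by (metis mult_0 less_irrefl)+
  moreover have "coprime a b"
    using d_pos div_gcd_coprime[of d2 d1] by (simp add: a_def b_def gcd.commute)
  ultimately have ab: "0 < a" "0 < b" "coprime a b" by simp_all
  have ratio: "b * d2 = a * d1" using d12 by (metis mult.assoc mult.commute)

  define wt where "wt = (\<lambda>(i, j). i * d1 + j * d2)"
  define D where "D = Max (wt ` mon2 F)"
  have "X1 \<noteq> (0 :: 'a poly poly)" by (simp add: X1_def)
  then have "F \<noteq> 0" using fgF comm_hom.hom_zero[OF comm_hom_endo2] by metis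
  then have ne: "mon2 F \<noteq> {}" by (simp add: mon2_eq_empty_iff)
  have D: "i * d1 + j * d2 \<le> D" if "coeff (coeff F j) i \<noteq> 0" for i j
  proof -
    have "wt (i, j) \<in> wt ` mon2 F" using that by (intro imageI) (simp add: mon2_def)
    then have "wt (i, j) \<le> D" unfolding D_def by (intro Max_ge finite_imageI finite_mon2)
    then show ?thesis by (simp add: wt_def)
  qed
  \<comment> \<open>For \<open>D = 0\<close> the polynomial \<open>F\<close> would be constant. A
    positive \<open>D\<close> exceeds the degree of \<open>F(f, g) = X1\<close> in
    \<open>x2\<close>, so the coefficient at \<open>D\<close> vanishes.\<close>
  have "D \<noteq> 0"
  proof
    assume "D = 0"
    then have "mon2 F \<subseteq> {(0, 0)}" using D d_pos by (fastforce simp: mon2_def)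
    then have "mon2 F = {(0, 0)}" using ne by blast
    then have "X1 = const2 (coeff (coeff F 0) 0)"
      using fgF eval2_sum[OF comm_hom_const2, of f g F] by (simp add: endo2_eval2)
    then show False by (simp add: X1_def const2_def)
  qed
  define Q where "Q = wpart d1 d2 D F"
  have "Max (wt ` mon2 F) \<in> wt ` mon2 F" using ne by (intro Max_in) auto
  then obtain i j where ij: "(i, j) \<in> mon2 F" "wt (i, j) = D" by (auto simp: D_def)
  then have "(i, j) \<in> mon2 Q" by (simp add: Q_def mon2_wpart wt_def)
  then have "Q \<noteq> 0" using mon2_eq_empty_iff by blast
  have "degree_lt D (eval2 const2 f g F) (eval2 (\<lambda>a. [:a:]) (lead_coeff f) (lead_coeff g) Q)"
    unfolding Q_def
    by (rule degree_lt.lt_eval2)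
      (use D in \<open>auto simp: degree_lt_def const2_def d1_def d2_def intro: comm_hom_const2 comm_hom_const_poly\<close>)
  then have "eval2 (\<lambda>a. [:a:]) (lead_coeff f) (lead_coeff g) Q = 0"
    using fgF \<open>D \<noteq> 0\<close> by (auto simp: degree_lt_def X1_def coeff_pCons simp flip: endo2_eval2 split: nat.splits)
  moreover have "i * b + j * a = D div gcd d1 d2" if "coeff (coeff Q j) i \<noteq> 0" for i j
  proof -
    have "D = (i * b + j * a) * gcd d1 d2"
      using that d12 by (auto simp: Q_def coeff_wpart add_mult_distrib mult.assoc split: if_splits)
    then show ?thesis using d_pos by simp
  qed
  moreover have "lead_coeff f \<noteq> 0" "lead_coeff g \<noteq> 0" using deg by auto
  ultimately obtain c where c: "c \<noteq> 0" "lead_coeff f ^ a = smult c (lead_coeff g ^ b)"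
    "X1 ^ a - const2 c * X2 ^ b dvd Q"
    using weighted_homogeneous_vanishing[OF \<open>Q \<noteq> 0\<close> ab] by blast
  have "a = 1 \<or> b = 1"
  proof (rule ccontr)
    assume "\<not> ?thesis"
    then have ab2: "2 \<le> a" "2 \<le> b" using ab by auto
    define hB :: "'a \<Rightarrow> 'a poly poly poly" where "hB a = [:const2 a:]" for a
    have hB: "comm_hom hB"
      unfolding hB_def by (intro comm_hom_comp[OF comm_hom_const_poly comm_hom_const2])
    obtain U V where UV: "poly U 0 = X1" "poly V 0 = X2" "degree U \<noteq> 0 \<or> degree V \<noteq> 0"
      and inv: "eval2 hB U V Q = [:Q:]"
      using leading_flow[OF fgF fgG FGf FGg D] unfolding Q_def hB_def by blast
    obtain R where R: "Q = (X1 ^ a - const2 c * X2 ^ b) * R" using c(3) by (rule dvdE)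
    interpret e: comm_hom "eval2 hB U V" by (rule comm_hom_eval2[OF hB])
    let ?P = "U ^ a - smult (const2 c) (V ^ b)"
    \<comment> \<open>\<open>?P\<close> divides a nonzero constant in \<open>T\<close>, so it is
      free of \<open>T\<close> and equals its value at \<open>T = 0\<close>.\<close>
    have "?P * eval2 hB U V R = [:Q:]"
      using inv unfolding R by (simp add: e.hom_mult e.hom_diff e.hom_power hB) (simp add: hB_def)
    then have "degree (?P * eval2 hB U V R) = 0" "?P * eval2 hB U V R \<noteq> 0"
      using \<open>Q \<noteq> 0\<close> by simp_all
    then have "degree ?P = 0" by (metis add_is_0 degree_mult_eq mult_eq_0_iff)
    then obtain y where y: "?P = [:y:]" by (rule degree_eq_zeroE)
    have "y = poly ?P 0" unfolding y by simp
    then have "y = X1 ^ a - const2 c * X2 ^ b" using UV by simp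
    then have "?P = [:X1 ^ a - const2 c * X2 ^ b:]" using y by simp
    then show False using cusp_flow_degree_0_field[OF UV(1,2) c(1) ab2 ab(3)] UV(3) by blast
  qed
  then show ?thesis
  proof
    assume "a = 1"
    then have "degree f = b * degree g" "lead_coeff f = smult c (lead_coeff g ^ b)"
      using ratio c by (simp_all add: d1_def d2_def)
    then show ?thesis using c ab by blast
  next
    assume "b = 1"
    then have "degree g = a * degree f" "lead_coeff g = smult (1 / c) (lead_coeff f ^ a)"
      using ratio c by (simp_all add: d1_def d2_def)
    moreover have "1 / c \<noteq> 0" using c by simp
    ultimately show ?thesis using ab by blast
  qed
qed

subsection \<open>Reduction of automorphisms and shift-invariant polynomials\<close>

text \<open>In characteristic \<open>p\<close> this is the product of all \<open>x - i * t\<close>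
  with \<open>i\<close> in the prime field, whence its invariance under translation by
  \<open>t\<close>.\<close>

definition artin_schreier :: "'a::comm_ring_1 \<Rightarrow> nat \<Rightarrow> 'a poly" where
  "artin_schreier t p = [:0, 1:] ^ p - smult (t ^ (p - 1)) [:0, 1:]"

lemma comm_hom_pcompose: "comm_hom (\<lambda>q. pcompose q r)"
  by unfold_locales (simp_all add: pcompose_1 pcompose_add pcompose_mult)

lemma degree_artin_schreier:
  assumes "1 < p"
  shows "degree (artin_schreier (t :: 'a::idom) p) = p"
proof -
  have "degree (- smult (t ^ (p - 1)) [:0, 1:]) < degree ([:0, 1 :: 'a:] ^ p)"
    unfolding degree_minus
    using assms by (intro le_less_trans[OF degree_smult_le]) (simp add: degree_power_eq)
  then have "degree ([:0, 1:] ^ p + - smult (t ^ (p - 1)) [:0, 1:]) = degree ([:0, 1 :: 'a:] ^ p)"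
    by (rule degree_add_eq_left)
  then show ?thesis
    by (simp only: artin_schreier_def diff_conv_add_uminus) (simp add: degree_power_eq)
qed

lemma pcompose_artin_schreier_shift:
  assumes "CHAR('a::field) = p" "0 < p"
  shows "pcompose (artin_schreier t p) [:t :: 'a, 1:] = artin_schreier t p"
proof -
  have "prime p" using assms prime_CHAR_semidom by blast
  then have "([:t:] + [:0, 1:]) ^ p = [:t:] ^ p + [:0, 1 :: 'a:] ^ p"
    using assms by (intro freshmans_dream) auto
  then have "[:t, 1:] ^ p = [:t ^ p:] + [:0, 1 :: 'a:] ^ p"
    by (simp only: poly_const_pow add_pCons add_0 add_0_right)
  moreover have "t * t ^ (p - 1) = t ^ p" using assms by (cases p) auto
  ultimately show ?thesis
    by (simp add: artin_schreier_def pcompose_diff pcompose_smult comm_hom.hom_power[OF comm_hom_pcompose]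
      pcompose_pCons mult.commute)
qed

text \<open>Divide by the invariant \<open>artin_schreier t p\<close>: for degree reasons, quotient
  and remainder are invariant too. An invariant of degree below \<open>p\<close> has one value at
  the \<open>p\<close> distinct points \<open>i * t\<close>, so the remainder is constant; induction
  handles the quotient.\<close>

lemma shift_invariant_imp_pcompose:
  fixes t :: "'a::field"
  assumes p: "CHAR('a) = p" "0 < p" and t: "t \<noteq> 0" and "pcompose q [:t, 1:] = q"
  shows "\<exists>r. q = pcompose r (artin_schreier t p)"
  using assms(4)
proof (induction "degree q" arbitrary: q rule: less_induct)
  case less
  let ?s = "artin_schreier t p"
  have "prime p" using p prime_CHAR_semidom by blast
  then have deg_s: "degree ?s = p" by (intro degree_artin_schreier prime_gt_1_nat)
  have const: "\<exists>x. r = [:x:]" if "degree r < p" "pcompose r [:t, 1:] = r" for r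
  proof -
    have step: "poly r (x + t) = poly r x" for x
      using arg_cong[OF that(2), of "\<lambda>q. poly q x"] by (simp add: poly_pcompose add.commute)
    have const: "poly r (of_nat i * t) = poly r 0" for i
      using step[of "of_nat _ * t"] by (induction i) (simp_all add: algebra_simps)
    have "inj_on (\<lambda>i. of_nat i * t) {..<p}"
      using t p by (auto simp: inj_on_def of_nat_eq_iff_cong_CHAR cong_def)
    then have "card ((\<lambda>i. of_nat i * t) ` {..<p}) = p" by (simp add: card_image)
    then have "r = [:poly r 0:]"
      using const that(1) by (intro poly_eqI_degree[of "(\<lambda>i. of_nat i * t) ` {..<p}"]) auto
    then show ?thesis ..
  qed
  show ?case
  proof (cases "degree q < p")
    case True
    then obtain x where "q = [:x:]" using const less.prems by blast
    then show ?thesis by (intro exI[of _ "[:x:]"]) simp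
  next
    case False
    define a where "a = q div ?s"
    define b where "b = q mod ?s"
    have s0: "?s \<noteq> 0" using deg_s p by auto
    have q: "q = ?s * a + b" by (simp add: a_def b_def)
    have deg_b: "degree b < p"
      using degree_mod_less[OF s0, of q] p by (auto simp: b_def deg_s)
    have sh: "pcompose ?s [:t, 1:] = ?s" using p by (rule pcompose_artin_schreier_shift)
    let ?a = "pcompose a [:t, 1:]" and ?b = "pcompose b [:t, 1:]"
    have "q = ?s * ?a + ?b"
      using less.prems unfolding q by (simp add: pcompose_add pcompose_mult sh)
    then have eq: "?s * (?a - a) = b - ?b" using q by (simp add: algebra_simps)
    have "degree (b - ?b) < p"
      using deg_b degree_diff_le_max[of b ?b] by (simp add: degree_pcompose)
    then have "?a = a"
    proof (rule contrapos_pp)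
      assume "?a \<noteq> a"
      then have "degree (?s * (?a - a)) = p + degree (?a - a)"
        using s0 by (subst degree_mult_eq) (auto simp: deg_s)
      then show "\<not> degree (b - ?b) < p" unfolding eq by simp
    qed
    then have "?b = b" using eq by simp
    then obtain x where x: "b = [:x:]" using const deg_b by blast
    have "a \<noteq> 0" using q deg_b False by auto
    then have "degree (?s * a) = p + degree a" using s0 by (simp add: degree_mult_eq deg_s)
    then have "degree q = p + degree a" unfolding q using deg_b by (subst degree_add_eq_left) auto
    then obtain r where r: "a = pcompose r ?s" using less.hyps[OF _ \<open>?a = a\<close>] p by auto
    have "q = pcompose ([:0, 1:] * r + [:x:]) ?s"
      by (subst q) (simp only: pcompose_add pcompose_mult pcompose_const x r, simp add: pcompose_pCons)
    then show ?thesis ..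
  qed
qed

section \<open>Endomorphisms, substitution and degrees\<close>

lemma kalg_endo_comm_hom: "kalg_endo \<phi> \<Longrightarrow> comm_hom \<phi>"
  unfolding kalg_endo_def by unfold_locales (auto simp: const2_hom[symmetric])

lemma kalg_endo_const2: "kalg_endo \<phi> \<Longrightarrow> \<phi> (const2 a) = const2 a"
  by (simp add: kalg_endo_def)

lemma kalg_endo_eqI:
  "kalg_endo \<phi> \<Longrightarrow> kalg_endo \<psi> \<Longrightarrow> \<phi> X1 = \<psi> X1 \<Longrightarrow> \<phi> X2 = \<psi> X2 \<Longrightarrow> \<phi> = \<psi>"
  using kalg_endo_eq_endo2[of \<phi>] kalg_endo_eq_endo2[of \<psi>] by simp

lemma kalg_endo_comp: "kalg_endo \<phi> \<Longrightarrow> kalg_endo \<psi> \<Longrightarrow> kalg_endo (\<phi> \<circ> \<psi>)"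
  by (simp add: kalg_endo_def)

lemma kalg_endo_eval1: "kalg_endo \<phi> \<Longrightarrow> \<phi> (eval1 q f) = eval1 q (\<phi> f)"
  unfolding eval1_def
  by (simp add: hom_poly_map_poly[OF kalg_endo_comm_hom comm_hom_const2] kalg_endo_const2)

lemma kalg_endo_id: "kalg_endo id"
  by (simp add: kalg_endo_def)

lemma comm_hom_eval1: "comm_hom (\<lambda>q. eval1 q f)"
  unfolding eval1_def by (rule comm_hom.comm_hom_poly_map_poly[OF comm_hom_const2])

lemma eval1_conv_pcompose: "eval1 q f = pcompose (map_poly (\<lambda>a. [:a:]) q) f"
  by (simp add: pcompose_altdef eval1_def map_poly_map_poly comp_def const2_def[abs_def])

lemma degree_eval1:
  "degree (eval1 q f) = degree q * degree (f :: 'a::idom poly poly)"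
  by (simp add: eval1_conv_pcompose degree_pcompose degree_map_poly)

lemma eval1_pcompose: "eval1 (pcompose q r) f = eval1 q (eval1 r f)"
proof -
  interpret comm_hom "\<lambda>q. eval1 q f" by (rule comm_hom_eval1)
  show ?thesis
    by (induction q) (simp_all add: pcompose_pCons hom_add hom_mult eval1_pCons eval1_hom)
qed

lemma eval1_const_poly: "eval1 q [:r:] = [:pcompose q r:]"
  by (induction q) (simp_all add: eval1_pCons pcompose_pCons eval1_hom const2_def)

lemma eval1_linear: "eval1 [:a, b:] f = const2 a + const2 b * f"
  by (simp add: eval1_pCons eval1_hom const2_hom mult.commute)

lemma eval1_X1: "eval1 q X1 = [:q:]"
  by (simp add: X1_def eval1_const_poly)

lemma eval1_artin_schreier: "eval1 (artin_schreier t p) f = f ^ p - const2 (t ^ (p - 1)) * f"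
proof -
  interpret comm_hom "\<lambda>q. eval1 q f" by (rule comm_hom_eval1)
  have "eval1 [:0, 1:] f = f" using eval1_linear[of 0 1 f] by (simp add: const2_hom)
  moreover have "smult (t ^ (p - 1)) [:0, 1:] = [:t ^ (p - 1):] * [:0, 1:]" by simp
  ultimately show ?thesis
    unfolding artin_schreier_def by (simp only: hom_diff hom_power hom_mult eval1_hom)
qed

text \<open>If \<open>x1\<close> goes to a polynomial in \<open>x1\<close> alone, the map is a
  change of coefficients followed by composition in \<open>x2\<close>, whose degree is
  computable.\<close>

lemma endo2_const_poly_fst:
  "endo2 [:r:] G q = pcompose (map_poly (\<lambda>c. pcompose c r) q) G"
  by (simp add: endo2_def eval1_const_poly pcompose_altdef map_poly_map_poly comp_def)

lemma X1_shift: "X1 + const2 t = [:[:t, 1:]:]"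
  by (simp add: X1_def const2_def)

lemma endo2_shift: "endo2 (X1 + const2 t) X2 q = map_poly (\<lambda>c. pcompose c [:t, 1:]) q"
  unfolding X1_shift endo2_const_poly_fst by (simp add: X2_def)

lemma degree_endo2_shift:
  "degree (endo2 (X1 + const2 t) X2 q) = degree (q :: 'a::idom poly poly)"
  unfolding endo2_shift by (rule degree_map_poly) (auto dest: pcompose_eq_0)

section \<open>The automorphism group and degree reduction\<close>

lemma kAut_mult: "\<phi> \<otimes>\<^bsub>kAut\<^esub> \<psi> = \<phi> \<circ> \<psi>"
  and kAut_carrier: "\<phi> \<in> carrier kAut \<longleftrightarrow> kalg_endo \<phi> \<and> bij \<phi>"
  by (simp_all add: kAut_def)

lemma kAut_inverse:
  assumes "\<phi> \<in> carrier kAut"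
  obtains \<psi> where "\<psi> \<in> carrier kAut" "\<And>x. \<phi> (\<psi> x) = x" "\<And>x. \<psi> (\<phi> x) = x"
proof -
  interpret group kAut by (rule group_kAut)
  have "inv\<^bsub>kAut\<^esub> \<phi> \<in> carrier kAut" "\<phi> \<circ> inv\<^bsub>kAut\<^esub> \<phi> = id" "inv\<^bsub>kAut\<^esub> \<phi> \<circ> \<phi> = id"
    using assms l_inv r_inv by (simp_all add: kAut_mult) (simp_all add: kAut_def)
  then show ?thesis using that by (metis comp_apply id_apply)
qed

lemma kAutI:
  assumes "kalg_endo \<phi>" "kalg_endo \<psi>"
    and "\<phi> (\<psi> X1) = X1" "\<phi> (\<psi> X2) = X2" "\<psi> (\<phi> X1) = X1" "\<psi> (\<phi> X2) = X2"
  shows "\<phi> \<in> carrier kAut"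
proof -
  have "\<phi> \<circ> \<psi> = id" "\<psi> \<circ> \<phi> = id"
    using assms by (auto intro!: kalg_endo_eqI kalg_endo_comp kalg_endo_id)
  then show ?thesis using assms(1) o_bij by (auto simp: kAut_carrier)
qed

lemma degree_less_if_coeff_0:
  assumes "degree r \<le> n" "coeff r n = 0" "0 < n"
  shows "degree r < n"
  using assms by (metis leading_coeff_0_iff degree_0 le_neq_implies_less)

lemma degree_diff_scaled_power_less:
  fixes f g :: "'a::field poly poly"
  assumes "degree g = n * degree f" "lead_coeff g = smult c (lead_coeff f ^ n)" "0 < degree g"
  shows "degree (g - const2 c * f ^ n) < degree g"
proof (rule degree_less_if_coeff_0)
  have "f \<noteq> 0" using assms by auto
  then have *: "degree (f ^ n) = degree g" using assms by (simp add: degree_power_eq)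
  have "const2 c * f ^ n = smult [:c:] (f ^ n)" by (simp add: const2_def)
  then have "degree (const2 c * f ^ n) \<le> degree g" using * by (simp add: degree_smult_le)
  then show "degree (g - const2 c * f ^ n) \<le> degree g" by (intro degree_diff_le) auto
  have "coeff (f ^ n) (degree g) = lead_coeff f ^ n" using * lead_coeff_power[of f n] by simp
  then show "coeff (g - const2 c * f ^ n) (degree g) = 0" by (simp add: const2_def assms(2))
qed fact

text \<open>\<open>automorphism_lead_coeff\<close> leaves open which leading coefficient is the
  power. If its direction goes against the degree comparison, the degrees agree, the exponent is
  \<open>1\<close>, and the relation can be inverted.\<close>

lemma automorphism_reduce:
  fixes \<phi> :: "'a::field poly poly \<Rightarrow> 'a poly poly"
  assumes \<phi>: "\<phi> \<in> carrier kAut" and deg: "0 < degree (\<phi> X1)" "0 < degree (\<phi> X2)"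
  shows "degree (\<phi> X1) \<le> degree (\<phi> X2) \<Longrightarrow>
      \<exists>c n. 0 < n \<and> degree (\<phi> X2 - const2 c * \<phi> X1 ^ n) < degree (\<phi> X2)"
    and "degree (\<phi> X2) \<le> degree (\<phi> X1) \<Longrightarrow>
      \<exists>c n. 0 < n \<and> degree (\<phi> X1 - const2 c * \<phi> X2 ^ n) < degree (\<phi> X1)"
proof -
  obtain \<psi> where \<psi>: "\<psi> \<in> carrier kAut" "\<And>x. \<phi> (\<psi> x) = x" "\<And>x. \<psi> (\<phi> x) = x"
    using kAut_inverse[OF \<phi>] by blast
  define f where "f = \<phi> X1"
  define g where "g = \<phi> X2"
  have "endo2 f g = \<phi>" "endo2 (\<psi> X1) (\<psi> X2) = \<psi>"
    using \<phi> \<psi>(1) kalg_endo_eq_endo2[of \<phi>] kalg_endo_eq_endo2[of \<psi>]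
    by (simp_all add: kAut_carrier f_def g_def)
  then have "endo2 f g (\<psi> X1) = X1" "endo2 f g (\<psi> X2) = X2"
    "endo2 (\<psi> X1) (\<psi> X2) f = X1" "endo2 (\<psi> X1) (\<psi> X2) g = X2"
    using \<psi> by (simp_all add: f_def g_def)
  note lead = automorphism_lead_coeff[OF this deg[folded f_def g_def]]
  have swap: "degree v = n * degree u \<Longrightarrow> degree v \<le> degree u \<Longrightarrow> 0 < n \<Longrightarrow> 0 < degree u \<Longrightarrow>
      lead_coeff v = smult c (lead_coeff u ^ n) \<Longrightarrow> c \<noteq> 0 \<Longrightarrow>
      degree u = 1 * degree v \<and> lead_coeff u = smult (1 / c) (lead_coeff v ^ 1)"
    for u v :: "'a poly poly" and c n
    by (cases "n = 1") auto
  show "\<exists>c n. 0 < n \<and> degree (\<phi> X2 - const2 c * \<phi> X1 ^ n) < degree (\<phi> X2)"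
    if "degree (\<phi> X1) \<le> degree (\<phi> X2)"
  proof -
    have "\<exists>c n. 0 < n \<and> degree g = n * degree f \<and> lead_coeff g = smult c (lead_coeff f ^ n)"
      using lead swap[of f _ g] that deg unfolding f_def[symmetric] g_def[symmetric]
      by (metis zero_less_one)
    then show ?thesis using degree_diff_scaled_power_less[of g _ f] deg
      unfolding f_def[symmetric] g_def[symmetric] by blast
  qed
  show "\<exists>c n. 0 < n \<and> degree (\<phi> X1 - const2 c * \<phi> X2 ^ n) < degree (\<phi> X1)"
    if "degree (\<phi> X2) \<le> degree (\<phi> X1)"
  proof -
    have "\<exists>c n. 0 < n \<and> degree f = n * degree g \<and> lead_coeff f = smult c (lead_coeff g ^ n)"
      using lead swap[of g _ f] that deg unfolding f_def[symmetric] g_def[symmetric]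
      by (metis zero_less_one)
    then show ?thesis using degree_diff_scaled_power_less[of f _ g] deg
      unfolding f_def[symmetric] g_def[symmetric] by blast
  qed
qed

lemma elementary1_kAut: "endo2 (X1 + eval1 q X2) X2 \<in> carrier kAut"
  by (rule kAutI[where \<psi> = "endo2 (X1 + eval1 (- q) X2) X2"])
    (simp_all add: kalg_endo_endo2 comm_hom.hom_add[OF comm_hom_endo2] comm_hom.hom_diff[OF comm_hom_endo2] kalg_endo_eval1
      comm_hom.hom_uminus[OF comm_hom_eval1])

lemma elementary2_kAut: "endo2 X1 (X2 + eval1 q X1) \<in> carrier kAut"
  by (rule kAutI[where \<psi> = "endo2 X1 (X2 + eval1 (- q) X1)"])
    (simp_all add: kalg_endo_endo2 comm_hom.hom_add[OF comm_hom_endo2] comm_hom.hom_diff[OF comm_hom_endo2] kalg_endo_eval1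
      comm_hom.hom_uminus[OF comm_hom_eval1])

lemma eval1_monom: "eval1 (monom c n) f = const2 c * f ^ n"
proof -
  interpret comm_hom "\<lambda>q. eval1 q f" by (rule comm_hom_eval1)
  have "monom c n = [:c:] * [:0, 1:] ^ n" by (simp add: monom_altdef)
  moreover have "eval1 [:0, 1:] f = f" using eval1_linear[of 0 1 f] by (simp add: const2_hom)
  ultimately show ?thesis by (simp only: hom_mult hom_power eval1_hom)
qed

text \<open>Each step composes with an elementary automorphism fixing \<open>X1\<close>:
  \<open>\<phi> X1\<close> is kept while the degree of \<open>\<phi> X2\<close> drops, and the
  subtracted monomials add up to \<open>q\<close>.\<close>

lemma automorphism_reduce_below:
  fixes \<phi> :: "'a::field poly poly \<Rightarrow> 'a poly poly"
  assumes "\<phi> \<in> carrier kAut" "0 < degree (\<phi> X1)"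
  shows "\<exists>q. degree (\<phi> X2 - eval1 q (\<phi> X1)) < degree (\<phi> X1)"
  using assms
proof (induction "degree (\<phi> X2)" arbitrary: \<phi> rule: less_induct)
  case less
  show ?case
  proof (cases "degree (\<phi> X2) < degree (\<phi> X1)")
    case True
    then show ?thesis by (intro exI[of _ 0]) (simp add: eval1_hom)
  next
    case False
    then obtain c n where n: "degree (\<phi> X2 - const2 c * \<phi> X1 ^ n) < degree (\<phi> X2)"
      using automorphism_reduce(1)[of \<phi>] less.prems by (metis le_trans linorder_not_less not_less_zero gr0I)
    let ?e = "endo2 X1 (X2 + eval1 (monom (- c) n) X1)"
    have \<phi>: "kalg_endo \<phi>" using less.prems by (simp add: kAut_carrier)
    have "\<phi> \<circ> ?e \<in> carrier kAut"
      using group.is_monoid[OF group_kAut] monoid.m_closed[of kAut \<phi> ?e] less.prems elementary2_kAut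
      by (auto simp: kAut_mult)
    moreover have X: "(\<phi> \<circ> ?e) X1 = \<phi> X1" "(\<phi> \<circ> ?e) X2 = \<phi> X2 + eval1 (monom (- c) n) (\<phi> X1)"
      by (simp_all add: comm_hom.hom_add[OF kalg_endo_comm_hom[OF \<phi>]] kalg_endo_eval1[OF \<phi>])
    moreover have "(\<phi> \<circ> ?e) X2 = \<phi> X2 - const2 c * \<phi> X1 ^ n"
      unfolding X by (simp add: eval1_monom comm_hom.hom_uminus[OF comm_hom_const2])
    ultimately obtain q where q: "degree (\<phi> X2 + eval1 (monom (- c) n) (\<phi> X1) - eval1 q (\<phi> X1)) < degree (\<phi> X1)"
      using less.hyps[of "\<phi> \<circ> ?e"] n less.prems by auto
    then show ?thesis
      by (intro exI[of _ "q - monom (- c) n"])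
        (simp add: comm_hom.hom_diff[OF comm_hom_eval1] algebra_simps)
  qed
qed

subsection \<open>The centralizer of a translation\<close>

lemma degree_X1 [simp]: "degree X1 = 0"
  by (simp add: X1_def)

lemma degree_X2 [simp]: "degree X2 = 1"
  by (simp add: X2_def)

lemma degree_eq_1_imp:
  assumes "degree q = 1"
  obtains a b where "q = [:a, b:]" "b \<noteq> 0"
proof -
  obtain a r where q: "q = pCons a r" by (cases q)
  have r: "r \<noteq> 0" "degree r = 0" using assms by (auto simp: q split: if_splits)
  from r(2) obtain b where "r = [:b:]" by (rule degree_eq_zeroE)
  then show ?thesis using q r that by auto
qed

lemma degree_const2 [simp]: "degree (const2 a) = 0"
  by (simp add: const2_def)

section \<open>Inverses in \<open>H0\<close>, the centralizer and the generators of
  \<open>H(t)\<close>\<close>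

lemma H0_I:
  assumes "kalg_endo \<phi>" "\<phi> X1 = X1 + const2 u" "\<phi> X2 = const2 a * X2 + const2 v" "a \<noteq> 0"
  shows "\<phi> \<in> H0"
  using assms kalg_endo_eq_endo2[OF assms(1)] by (auto simp: H0_def)

lemma H0_inverse:
  assumes "\<phi> \<in> H0"
  shows "\<phi> \<in> carrier kAut" "inv\<^bsub>kAut\<^esub> \<phi> \<in> H0"
proof -
  interpret group kAut by (rule group_kAut)
  interpret c: comm_hom const2 by (rule comm_hom_const2)
  obtain a u v where \<phi>: "\<phi> = endo2 (X1 + const2 u) (const2 a * X2 + const2 v)" "a \<noteq> 0"
    using assms by (auto simp: H0_def)
  define \<psi> where "\<psi> = endo2 (X1 + const2 (- u)) (const2 (1 / a) * X2 + const2 (- v / a))"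
  have e: "kalg_endo \<phi>" "kalg_endo \<psi>" by (simp_all add: \<phi> \<psi>_def kalg_endo_endo2)
  interpret \<phi>: comm_hom \<phi> using e(1) by (rule kalg_endo_comm_hom)
  interpret \<psi>: comm_hom \<psi> using e(2) by (rule kalg_endo_comm_hom)
  have X: "\<phi> X1 = X1 + const2 u" "\<phi> X2 = const2 a * X2 + const2 v"
    "\<psi> X1 = X1 + const2 (- u)" "\<psi> X2 = const2 (1 / a) * X2 + const2 (- v / a)"
    by (simp_all add: \<phi> \<psi>_def)
  have [simp]: "const2 a * (const2 b * x) = const2 (a * b) * x" for a b and x :: "'a poly poly"
    by (simp add: c.hom_mult)
  note simps = X \<phi>.hom_add \<phi>.hom_diff \<phi>.hom_mult \<psi>.hom_add \<psi>.hom_mult kalg_endo_const2[OF e(1)]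
    kalg_endo_const2[OF e(2)] distrib_left
  have 1: "\<phi> (\<psi> X1) = X1" "\<psi> (\<phi> X1) = X1"
    by (simp_all add: simps c.hom_uminus)
  have 2: "\<phi> (\<psi> X2) = X2" "\<psi> (\<phi> X2) = X2"
    using \<phi>(2) by (simp_all add: simps add.assoc flip: c.hom_add c.hom_mult)
  show \<phi>_in: "\<phi> \<in> carrier kAut" using kAutI[OF e] 1 2 by simp
  have \<psi>_in: "\<psi> \<in> carrier kAut" using kAutI[OF e(2,1)] 1 2 by simp
  have "\<psi> \<circ> \<phi> = id"
    using e 1 2 by (intro kalg_endo_eqI) (auto intro: kalg_endo_comp kalg_endo_id)
  then have "inv\<^bsub>kAut\<^esub> \<phi> = \<psi>"
    using \<phi>_in \<psi>_in by (intro inv_equality) (simp_all add: kAut_mult, simp add: kAut_def)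
  then show "inv\<^bsub>kAut\<^esub> \<phi> \<in> H0" using H0_I[OF e(2) X(3,4)] \<phi>(2) by simp
qed

lemma subgroup_centralizer:
  assumes "group G" "x \<in> carrier G"
  shows "subgroup (centralizer G x) G"
proof -
  interpret group G by fact
  show ?thesis
  proof (rule subgroupI)
    show "centralizer G x \<noteq> {}" using assms(2) by (auto simp: centralizer_def)
    fix y assume y: "y \<in> centralizer G x"
    then have yG: "y \<in> carrier G" and yx: "y \<otimes>\<^bsub>G\<^esub> x = x \<otimes>\<^bsub>G\<^esub> y" by (auto simp: centralizer_def)
    have "inv\<^bsub>G\<^esub> y \<otimes>\<^bsub>G\<^esub> x = inv\<^bsub>G\<^esub> y \<otimes>\<^bsub>G\<^esub> (x \<otimes>\<^bsub>G\<^esub> y) \<otimes>\<^bsub>G\<^esub> inv\<^bsub>G\<^esub> y"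
      using yG assms(2) by (simp add: m_assoc)
    also have "\<dots> = x \<otimes>\<^bsub>G\<^esub> inv\<^bsub>G\<^esub> y"
      unfolding yx[symmetric] using yG assms(2) by (simp flip: m_assoc)
    finally show "inv\<^bsub>G\<^esub> y \<in> centralizer G x" using yG by (simp add: centralizer_def)
    fix z assume "z \<in> centralizer G x"
    then show "y \<otimes>\<^bsub>G\<^esub> z \<in> centralizer G x"
      using yG yx assms(2) by (auto simp: centralizer_def) (metis m_assoc)
  qed (auto simp: centralizer_def)
qed

locale translation =
  fixes t :: "'a::field" and p :: nat
  assumes CHAR: "CHAR('a) = p" and p: "0 < p" and t: "t \<noteq> 0"
begin

abbreviation \<epsilon> :: "'a poly poly \<Rightarrow> 'a poly poly" where "\<epsilon> \<equiv> endo2 (X1 + const2 t) X2"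
abbreviation C where "C \<equiv> centralizer kAut \<epsilon>"
abbreviation as :: "'a poly" where "as \<equiv> artin_schreier t p"

definition E1 :: "'a poly \<Rightarrow> 'a poly poly \<Rightarrow> 'a poly poly" where
  "E1 q = endo2 (X1 + eval1 q X2) X2"

definition E2 :: "'a poly \<Rightarrow> 'a poly poly \<Rightarrow> 'a poly poly" where
  "E2 q = endo2 X1 (X2 + eval1 q (eval1 as X1))"

sublocale c: comm_hom const2 by (rule comm_hom_const2)

lemma shift_kAut: "\<epsilon> \<in> carrier kAut"
  using elementary1_kAut[of "[:t:]"] by (simp add: eval1_hom)

sublocale \<epsilon>: comm_hom \<epsilon> by (rule comm_hom_endo2)

text \<open>Endomorphisms agreeing on \<open>X1\<close> and \<open>X2\<close> are equal, so
  commutation is tested on the variables.\<close>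

lemma C_iff:
  "\<phi> \<in> C \<longleftrightarrow> \<phi> \<in> carrier kAut \<and> \<epsilon> (\<phi> X1) = \<phi> X1 + const2 t \<and> \<epsilon> (\<phi> X2) = \<phi> X2"
proof (cases "\<phi> \<in> carrier kAut")
  case True
  then have \<phi>: "kalg_endo \<phi>" by (simp add: kAut_carrier)
  have "\<phi> \<circ> \<epsilon> = \<epsilon> \<circ> \<phi> \<longleftrightarrow> (\<phi> \<circ> \<epsilon>) X1 = (\<epsilon> \<circ> \<phi>) X1 \<and> (\<phi> \<circ> \<epsilon>) X2 = (\<epsilon> \<circ> \<phi>) X2"
    using kalg_endo_eqI[OF kalg_endo_comp[OF \<phi> kalg_endo_endo2] kalg_endo_comp[OF kalg_endo_endo2 \<phi>]]
    by metis
  then show ?thesis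
    using True \<phi> by (auto simp: centralizer_def kAut_mult comm_hom.hom_add[OF kalg_endo_comm_hom]
      kalg_endo_const2)
qed (simp add: centralizer_def)

lemma C_carrier: "\<phi> \<in> C \<Longrightarrow> \<phi> \<in> carrier kAut"
  by (simp add: C_iff)

lemma subgroup_C: "subgroup C kAut"
  by (rule subgroup_centralizer[OF group_kAut shift_kAut])

lemma C_comp: "\<phi> \<in> C \<Longrightarrow> \<psi> \<in> C \<Longrightarrow> \<phi> \<circ> \<psi> \<in> C"
  using subgroup.m_closed[OF subgroup_C] by (metis kAut_mult)

lemma \<epsilon>_as: "\<epsilon> (eval1 as X1) = eval1 as X1"
  using pcompose_artin_schreier_shift[OF CHAR p, of t]
  by (simp add: eval1_X1 endo2_shift map_poly_pCons)

lemma E1_C: "E1 q \<in> C"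
  unfolding C_iff E1_def
  by (simp add: elementary1_kAut \<epsilon>.hom_add kalg_endo_eval1 kalg_endo_endo2 add_ac)

lemma E2_C: "E2 q \<in> C"
  unfolding C_iff E2_def eval1_pcompose[symmetric]
  by (simp add: elementary2_kAut \<epsilon>.hom_add) 
    (simp add: eval1_pcompose kalg_endo_eval1[OF kalg_endo_endo2, of _ _ _ "eval1 as X1"] \<epsilon>_as)

lemma H_eq: "H_grp p t = generate kAut ({E1 q | q. coeff q 0 = 0} \<union> {E2 q | q. coeff q 0 = 0})"
  by (simp add: H_grp_def E1_def E2_def eval1_artin_schreier)

lemma H_subgroup: "subgroup (H_grp p t) kAut"
  unfolding H_eq by (rule group.generate_is_subgroup[OF group_kAut]) (use E1_C E2_C C_iff in auto)

lemma H_subset_C: "H_grp p t \<subseteq> C"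
  unfolding H_eq
  by (rule group.generate_subgroup_incl[OF group_kAut _ subgroup_C]) (use E1_C E2_C in auto)

lemma E1_H: "coeff q 0 = 0 \<Longrightarrow> E1 q \<in> H_grp p t"
  and E2_H: "coeff q 0 = 0 \<Longrightarrow> E2 q \<in> H_grp p t"
  unfolding H_eq by (auto intro: generate.incl)

lemma H_comp: "g \<in> H_grp p t \<Longrightarrow> h \<in> H_grp p t \<Longrightarrow> g \<circ> h \<in> H_grp p t"
  using subgroup.m_closed[OF H_subgroup] by (metis kAut_mult)

lemma H0_subset_C: "H0 \<subseteq> C"
proof
  fix \<phi> :: "'a poly poly \<Rightarrow> 'a poly poly" assume \<phi>: "\<phi> \<in> H0"
  then obtain a u v where "\<phi> = endo2 (X1 + const2 u) (const2 a * X2 + const2 v)"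
    by (auto simp: H0_def)
  then show "\<phi> \<in> C" using H0_inverse(1)[OF \<phi>]
    by (simp add: C_iff \<epsilon>.hom_add \<epsilon>.hom_mult kalg_endo_const2[OF kalg_endo_endo2] add_ac)
qed

section \<open>Descent in the centralizer\<close>

lemma comp_E1:
  assumes "kalg_endo \<phi>"
  shows "(\<phi> \<circ> E1 q) X1 = \<phi> X1 + eval1 q (\<phi> X2)" "(\<phi> \<circ> E1 q) X2 = \<phi> X2"
  using assms by (simp_all add: E1_def comm_hom.hom_add[OF kalg_endo_comm_hom] kalg_endo_eval1)

lemma comp_E2:
  assumes "kalg_endo \<phi>"
  shows "(\<phi> \<circ> E2 q) X1 = \<phi> X1" "(\<phi> \<circ> E2 q) X2 = \<phi> X2 + eval1 q (eval1 as (\<phi> X1))"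
  using assms by (simp_all add: E2_def comm_hom.hom_add[OF kalg_endo_comm_hom] kalg_endo_eval1)

text \<open>If \<open>\<phi> X2 = q(x1)\<close>, the inverse \<open>\<psi>\<close> gives
  \<open>X2 = q(\<psi> X1)\<close>, so \<open>q\<close> has degree \<open>1\<close>. Such a
  \<open>q\<close> is not invariant under translation by \<open>t\<close>.\<close>

lemma C_degree_X2_pos:
  assumes \<phi>: "\<phi> \<in> C"
  shows "0 < degree (\<phi> X2)"
proof (rule ccontr)
  assume "\<not> ?thesis"
  then have "degree (\<phi> X2) = 0" by simp
  then obtain q where q: "\<phi> X2 = [:q:]" by (rule degree_eq_zeroE)
  obtain \<psi> where \<psi>: "\<psi> \<in> carrier kAut" "\<And>x. \<phi> (\<psi> x) = x" "\<And>x. \<psi> (\<phi> x) = x"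
    using kAut_inverse[OF C_carrier[OF \<phi>]] by blast
  have "X2 = \<psi> (eval1 q X1)" using \<psi>(3)[of X2] by (simp add: q eval1_X1)
  also have "\<dots> = eval1 q (\<psi> X1)" using \<psi>(1) by (simp add: kAut_carrier kalg_endo_eval1)
  finally have "degree (X2 :: 'a poly poly) = degree (eval1 q (\<psi> X1))" by (rule arg_cong)
  then have deg: "degree q = 1" by (simp add: degree_eval1)
  then obtain a b where ab: "q = [:a, b:]" "b \<noteq> 0"
    by (rule degree_eq_1_imp)
  have "pcompose q [:t, 1:] = q"
    using \<phi> by (simp add: C_iff q endo2_shift map_poly_pCons)
  then show False using ab t by (simp add: pcompose_pCons)
qed

text \<open>Degrees multiply under composition with the inverse, so \<open>\<phi> X1\<close> has
  degree \<open>1\<close> in \<open>x1\<close> and \<open>\<phi> X2\<close> has degree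
  \<open>1\<close> in \<open>x2\<close>. Commuting with \<open>\<epsilon>\<close> makes the slope of
  \<open>\<phi> X1\<close> equal to \<open>1\<close>.\<close>

lemma C_degree_X1_zero:
  assumes \<phi>: "\<phi> \<in> C" and deg: "degree (\<phi> X1) = 0"
  obtains u b q where "\<phi> X1 = X1 + const2 u" "\<phi> X2 = const2 b * X2 + eval1 q X1" "b \<noteq> 0"
    "pcompose q [:t, 1:] = q"
proof -
  obtain r where r: "\<phi> X1 = [:r:]" using deg by (rule degree_eq_zeroE)
  obtain \<psi> where \<psi>: "\<psi> \<in> carrier kAut" "\<And>x. \<phi> (\<psi> x) = x" "\<And>x. \<psi> (\<phi> x) = x"
    using kAut_inverse[OF C_carrier[OF \<phi>]] by blast
  have "\<epsilon> [:r:] = [:r:] + const2 t" using \<phi> by (simp add: C_iff r)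
  then have r_shift: "pcompose r [:t, 1:] = r + [:t:]"
    unfolding endo2_shift by (simp add: map_poly_pCons const2_def)
  have "degree r \<noteq> 0"
  proof
    assume "degree r = 0"
    then obtain x where "r = [:x:]" by (rule degree_eq_zeroE)
    then show False using r_shift t by simp
  qed
  have X1: "X1 = eval1 r (\<psi> X1)"
    using \<psi>(3)[of X1] kalg_endo_eval1[of \<psi> r X1] \<psi>(1)
    by (simp add: r eval1_X1 kAut_carrier)
  then have "degree r * degree (\<psi> X1) = 0" using degree_eval1[of r "\<psi> X1"] by simp
  then have "degree (\<psi> X1) = 0" using \<open>degree r \<noteq> 0\<close> by simp
  then obtain F where F: "\<psi> X1 = [:F:]" by (rule degree_eq_zeroE)
  have "X1 = [:pcompose r F:]" using X1 unfolding F eval1_const_poly .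
  then have "pcompose r F = [:0, 1:]" by (simp add: X1_def)
  then have "degree r * degree F = 1" using degree_pcompose[of r F] by simp
  then have degs: "degree r = 1" "degree F = 1" by simp_all
  obtain u b where ub: "r = [:u, b:]" using degs(1) by (rule degree_eq_1_imp)
  then have "b = 1" using r_shift t by (simp add: pcompose_pCons)
  then have f: "\<phi> X1 = X1 + const2 u" using r ub by (simp add: X1_def const2_def)
  \<comment> \<open>\<open>?g\<close> is \<open>\<phi> X2\<close> with \<open>F\<close> put for
    \<open>x1\<close>; applying \<open>\<psi>\<close> then becomes composition in
    \<open>x2\<close>.\<close>
  let ?g = "map_poly (\<lambda>c. pcompose c F) (\<phi> X2)"
  have inj: "pcompose c F \<noteq> 0" if "c \<noteq> 0" for c using pcompose_eq_0[of c F] degs that by auto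
  have "\<psi> (\<phi> X2) = endo2 [:F:] (\<psi> X2) (\<phi> X2)"
    using kalg_endo_eq_endo2[of \<psi>] \<psi>(1) by (simp add: kAut_carrier F)
  then have g: "pcompose ?g (\<psi> X2) = X2" using \<psi>(3) by (simp add: endo2_const_poly_fst)
  have "degree (\<phi> X2) * degree (\<psi> X2) = 1"
    using degree_pcompose[of ?g "\<psi> X2"] inj by (simp add: g degree_map_poly)
  then have "degree (\<phi> X2) = 1" by simp
  then obtain q y where qy: "\<phi> X2 = [:q, y:]" by (rule degree_eq_1_imp)
  \<comment> \<open>The coefficient \<open>y(F)\<close> is a unit of \<open>k[x1]\<close>, hence
    constant; since \<open>F\<close> has degree \<open>1\<close>, so is \<open>y\<close>.\<close>
  have "coeff (pcompose ?g (\<psi> X2)) 1 = pcompose y F * coeff (\<psi> X2) 1"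
    by (simp add: qy map_poly_pCons pcompose_pCons)
  then have y1: "pcompose y F * coeff (\<psi> X2) 1 = 1" unfolding g by (simp add: X2_def)
  then have "degree (pcompose y F * coeff (\<psi> X2) 1) = 0" by simp
  moreover have "pcompose y F \<noteq> 0" "coeff (\<psi> X2) 1 \<noteq> 0" using y1 by auto
  ultimately have "degree (pcompose y F) = 0" by (simp add: degree_mult_eq)
  then have "degree y = 0" using degs by (simp add: degree_pcompose)
  then obtain \<beta> where y: "y = [:\<beta>:]" by (rule degree_eq_zeroE)
  have "\<beta> \<noteq> 0" using y1 by (auto simp: y)
  moreover have "\<phi> X2 = const2 \<beta> * X2 + eval1 q X1"
    unfolding qy y eval1_X1 by (simp add: const2_def X2_def)
  moreover have "pcompose q [:t, 1:] = q"
    using \<phi> by (simp add: C_iff qy endo2_shift map_poly_pCons)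
  ultimately show ?thesis using f that by blast
qed

lemma C_base:
  assumes \<phi>: "\<phi> \<in> C" and deg: "degree (\<phi> X1) = 0"
  shows "\<exists>h\<in>H_grp p t. \<phi> \<circ> h \<in> H0"
proof -
  obtain u b q where X1: "\<phi> X1 = X1 + const2 u" and X2: "\<phi> X2 = const2 b * X2 + eval1 q X1"
    and b: "b \<noteq> 0" and q: "pcompose q [:t, 1:] = q"
    using C_degree_X1_zero[OF \<phi> deg] by blast
  have e: "kalg_endo \<phi>" using \<phi> by (simp add: C_iff kAut_carrier)
  \<comment> \<open>This expresses \<open>q(X1)\<close> through \<open>\<phi> X1 = X1 + u\<close>,
    the argument that \<open>E2\<close> acts with.\<close>
  let ?q = "pcompose q [:- u, 1:]"
  have "pcompose ?q [:t, 1:] = pcompose q (pcompose [:t, 1:] [:- u, 1:])"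
    by (simp add: pcompose_pCons flip: pcompose_assoc)
  also have "\<dots> = ?q" unfolding pcompose_assoc[of q] q ..
  finally have "pcompose ?q [:t, 1:] = ?q" .
  then obtain r where r: "?q = pcompose r as"
    using shift_invariant_imp_pcompose[OF CHAR p t] by blast
  have "eval1 (pcompose r as) (\<phi> X1) = eval1 q X1"
    unfolding r[symmetric] eval1_pcompose by (simp add: X1 eval1_linear c.hom_uminus const2_hom)
  then have r': "eval1 r (eval1 as (\<phi> X1)) = eval1 q X1" by (simp add: eval1_pcompose)
  \<comment> \<open>A generator needs constant term \<open>0\<close>, so \<open>coeff r 0\<close>
    stays behind as a translation in \<open>H0\<close>.\<close>
  let ?w = "[:coeff r 0:] - r"
  have "eval1 ?w (eval1 as (\<phi> X1)) = const2 (coeff r 0) - eval1 q X1"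
    by (simp add: comm_hom.hom_diff[OF comm_hom_eval1] eval1_hom r')
  then have "(\<phi> \<circ> E2 ?w) X2 = const2 b * X2 + const2 (coeff r 0)"
    unfolding comp_E2(2)[OF e] by (simp add: X2)
  moreover have "(\<phi> \<circ> E2 ?w) X1 = X1 + const2 u" unfolding comp_E2(1)[OF e] by (rule X1)
  moreover have "kalg_endo (\<phi> \<circ> E2 ?w)"
    by (intro kalg_endo_comp e) (simp add: E2_def kalg_endo_endo2)
  ultimately have "\<phi> \<circ> E2 ?w \<in> H0" using b by (intro H0_I)
  moreover have "E2 ?w \<in> H_grp p t" by (rule E2_H) simp
  ultimately show ?thesis by blast
qed

text \<open>As \<open>\<epsilon>\<close> fixes \<open>\<phi> X2\<close>, subtracting a monomial in
  it needs no invariance condition; a positive exponent \<open>n\<close> makes the constant term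
  vanish.\<close>

lemma C_reduce_X1:
  assumes \<phi>: "\<phi> \<in> C" and deg: "0 < degree (\<phi> X1)" "degree (\<phi> X2) \<le> degree (\<phi> X1)"
  shows "\<exists>h\<in>H_grp p t. degree ((\<phi> \<circ> h) X1) < degree (\<phi> X1) \<and> (\<phi> \<circ> h) X2 = \<phi> X2"
proof -
  have e: "kalg_endo \<phi>" and \<phi>_in: "\<phi> \<in> carrier kAut" using \<phi> by (simp_all add: C_iff kAut_carrier)
  obtain x n where n: "0 < n" "degree (\<phi> X1 - const2 x * \<phi> X2 ^ n) < degree (\<phi> X1)"
    using automorphism_reduce(2)[OF \<phi>_in deg(1) C_degree_X2_pos[OF \<phi>] deg(2)] by blast
  have "degree ((\<phi> \<circ> E1 (monom (- x) n)) X1) < degree (\<phi> X1)"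
    using n(2) by (simp only: comp_E1[OF e] eval1_monom c.hom_uminus) simp
  moreover have "E1 (monom (- x) n) \<in> H_grp p t" using n(1) by (intro E1_H) simp
  ultimately show ?thesis using comp_E1(2)[OF e] by blast
qed

lemma C_reduce_X2:
  assumes \<phi>: "\<phi> \<in> C" and deg: "0 < degree (\<phi> X1)"
  shows "\<exists>h\<in>H_grp p t. degree ((\<phi> \<circ> h) X2) \<le> degree (\<phi> X1) \<and> (\<phi> \<circ> h) X1 = \<phi> X1"
proof -
  have e: "kalg_endo \<phi>" and \<phi>_in: "\<phi> \<in> carrier kAut" using \<phi> by (simp_all add: C_iff kAut_carrier)
  define f where "f = \<phi> X1"
  define g where "g = \<phi> X2"
  have f: "\<epsilon> f = f + const2 t" and g: "\<epsilon> g = g" using \<phi> by (simp_all add: C_iff f_def g_def)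
  obtain q where q: "degree (g - eval1 q f) < degree f"
    using automorphism_reduce_below[OF \<phi>_in deg] by (auto simp: f_def g_def)
  interpret ev: comm_hom "\<lambda>q. eval1 q f" by (rule comm_hom_eval1)
  define d where "d = q - pcompose q [:t, 1:]"
  have "\<epsilon> (g - eval1 q f) = g - eval1 (pcompose q [:t, 1:]) f"
    by (simp add: \<epsilon>.hom_diff kalg_endo_eval1[OF kalg_endo_endo2] f g eval1_pcompose eval1_linear
      const2_hom add.commute)
  then have "\<epsilon> (g - eval1 q f) - (g - eval1 q f) = eval1 d f"
    by (simp add: d_def ev.hom_diff)
  moreover have "degree (\<epsilon> (g - eval1 q f) - (g - eval1 q f)) < degree f"
    by (rule degree_diff_less) (simp_all only: degree_endo2_shift q)
  ultimately have "degree d * degree f < degree f" by (simp add: degree_eval1)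
  then have "degree d = 0" by (cases "degree d") auto
  then obtain k where k: "d = [:k:]" by (rule degree_eq_zeroE)
  \<comment> \<open>The slope gives \<open>?l\<close> the same difference under the translation as
    \<open>q\<close>, so \<open>q - ?l\<close> is invariant.\<close>
  let ?l = "[:0, - k / t:]"
  have "pcompose q [:t, 1:] = q - [:k:]" using k by (simp add: d_def algebra_simps)
  then have "pcompose (q - ?l) [:t, 1:] = q - ?l"
    using t by (simp add: pcompose_diff pcompose_pCons)
  then obtain r where r: "q - ?l = pcompose r as"
    using shift_invariant_imp_pcompose[OF CHAR p t] by blast
  let ?w = "[:coeff r 0:] - r"
  have "eval1 r (eval1 as f) = eval1 q f - eval1 ?l f"
    by (simp only: eval1_pcompose[symmetric] r[symmetric] ev.hom_diff)
  then have "eval1 ?w (eval1 as f) = const2 (coeff r 0) - eval1 q f + eval1 ?l f"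
    by (simp add: comm_hom.hom_diff[OF comm_hom_eval1] eval1_hom)
  then have "(\<phi> \<circ> E2 ?w) X2 = (g - eval1 q f) + (const2 (coeff r 0) + eval1 ?l f)"
    by (simp only: comp_E2[OF e] f_def[symmetric] g_def[symmetric]) simp
  \<comment> \<open>The linear term cannot be removed, so the bound is not strict. It still gives a
    drop when \<open>\<phi> X2\<close> has larger degree than \<open>\<phi> X1\<close>.\<close>
  moreover have "degree (eval1 ?l f) \<le> degree f" by (simp add: degree_eval1)
  ultimately have "degree ((\<phi> \<circ> E2 ?w) X2) \<le> degree f"
    using q by (simp only:) (intro degree_add_le, simp_all)
  moreover have "E2 ?w \<in> H_grp p t" by (rule E2_H) simp
  ultimately show ?thesis using comp_E2(1)[OF e] unfolding f_def by blast
qed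

lemma C_descent: "\<phi> \<in> C \<Longrightarrow> \<exists>h\<in>H_grp p t. \<phi> \<circ> h \<in> H0"
proof (induction "degree (\<phi> X1) + degree (\<phi> X2)" arbitrary: \<phi> rule: less_induct)
  case less
  have step: ?case
    if h: "h \<in> H_grp p t" and less_h: "degree ((\<phi> \<circ> h) X1) + degree ((\<phi> \<circ> h) X2) < degree (\<phi> X1) + degree (\<phi> X2)" for h
  proof -
    have "\<phi> \<circ> h \<in> C" using less.prems h H_subset_C by (blast intro: C_comp)
    then obtain h' where "h' \<in> H_grp p t" "\<phi> \<circ> h \<circ> h' \<in> H0" using less.hyps[OF less_h] by blast
    then show ?thesis using H_comp[OF h] by (auto simp: comp_assoc)
  qed
  consider "degree (\<phi> X1) = 0" | "0 < degree (\<phi> X1)" "degree (\<phi> X2) \<le> degree (\<phi> X1)"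
    | "0 < degree (\<phi> X1)" "degree (\<phi> X1) < degree (\<phi> X2)" by linarith
  then show ?case
  proof cases
    case 1
    with less.prems show ?thesis by (rule C_base)
  next
    case 2
    then obtain h where "h \<in> H_grp p t" "degree ((\<phi> \<circ> h) X1) < degree (\<phi> X1)" "(\<phi> \<circ> h) X2 = \<phi> X2"
      using C_reduce_X1[OF less.prems] by blast
    then show ?thesis by (intro step[of h]) simp_all
  next
    case 3
    then obtain h where "h \<in> H_grp p t" "degree ((\<phi> \<circ> h) X2) \<le> degree (\<phi> X1)" "(\<phi> \<circ> h) X1 = \<phi> X1"
      using C_reduce_X2[OF less.prems] by blast
    with 3 show ?thesis by (intro step[of h]) simp_all
  qed
qed

lemma C_eq: "C = H_grp p t <#>\<^bsub>kAut\<^esub> H0"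
proof
  interpret group kAut by (rule group_kAut)
  show "H_grp p t <#>\<^bsub>kAut\<^esub> H0 \<subseteq> C"
    using H_subset_C H0_subset_C subgroup.m_closed[OF subgroup_C] by (auto simp: set_mult_def)
  show "C \<subseteq> H_grp p t <#>\<^bsub>kAut\<^esub> H0"
  proof
    fix \<phi> assume \<phi>: "\<phi> \<in> C"
    then have \<phi>_in: "\<phi> \<in> carrier kAut" by (simp add: C_iff)
    \<comment> \<open>The descent multiplies on the right, so applied to \<open>\<phi>\<close> it
      would put the \<open>H0\<close> factor first. Applied to the inverse, it gives the factors in
      the required order.\<close>
    have "inv\<^bsub>kAut\<^esub> \<phi> \<in> C" using subgroup.m_inv_closed[OF subgroup_C \<phi>] .
    then obtain h where h: "h \<in> H_grp p t" and h0: "inv\<^bsub>kAut\<^esub> \<phi> \<otimes>\<^bsub>kAut\<^esub> h \<in> H0"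
      using C_descent by (auto simp: kAut_mult)
    have h_in: "h \<in> carrier kAut" using h H_subset_C C_iff by blast
    have "\<phi> = h \<otimes>\<^bsub>kAut\<^esub> inv\<^bsub>kAut\<^esub> (inv\<^bsub>kAut\<^esub> \<phi> \<otimes>\<^bsub>kAut\<^esub> h)"
      using \<phi>_in h_in by (simp add: inv_mult_group flip: m_assoc)
    then show "\<phi> \<in> H_grp p t <#>\<^bsub>kAut\<^esub> H0"
      using h H0_inverse(2)[OF h0] unfolding set_mult_def by blast
  qed
qed

end

theorem theorem5p1:
  fixes t :: "'a::field" and p :: nat
  assumes "CHAR('a) = p" and "p > 0" and "t \<noteq> 0"
  shows "centralizer kAut (endo2 (X1 + const2 t) X2) = H_grp p t <#>\<^bsub>kAut\<^esub> H0"
proof -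
  interpret translation t p by unfold_locales fact+
  show ?thesis by (rule C_eq)
qed

end
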